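(* Let $(\mathbb{R}^{n+2},g_S)$ be a Cahen-Wallach space and let $\phi=\phi_{c,\epsilon,b,\beta,A,s}$ be a homothety of it that is not an isometry. Then the following are equivalent: (1) $\phi$ is essential; (2) $\phi$ has a fixed point; (3) $\epsilon=-1$ or $c=0$. In particular, when the Cahen-Wallach space is not conformally flat, every essential conformal transformation of it is a homothety, not an isometry, with these properties (1), (2), (3).
   Context: For $n\ge 1$ and a real symmetric $n\times n$ matrix $S$ with $\det S\neq 0$, the Cahen-Wallach space $(\mathbb{R}^{n+2},g_S)$ is $\mathbb{R}^{n+2}$ with global coordinates $(t,x,v)$, $t,v\in\mathbb{R}$, $x\in\mathbb{R}^n$, and Lorentzian metric $g_S=2\,dv\,dt+(x^\top S x)\,dt^2+dx^\top dx$. A conformal transformation of a semi-Riemannian manifold $(N,g)$ is a diffeomorphism $\phi:N\to N$ with $\phi^*g=e^{2f}g$ for some smooth function $f$ on $N$; it is a homothety if $f$ is constant. A conformal transformation $\phi$ is essential if there is no smooth function $h$ on $N$ such that $\phi$ is an isometry of $e^{2h}g$. A manifold is conformally flat if every point has a neighbourhood admitting a conformal diffeomorphism into a flat semi-Riemannian manifold. Every homothety of $(\mathbb{R}^{n+2},g_S)$ is of the form $$\phi_{c,\epsilon,b,\beta,A,s}(t,x,v)=\Big(\epsilon t+c,\ e^sAx+\beta(t),\ \epsilon\big(e^{2s}v+b-\langle\dot\beta(t),e^sAx+\tfrac12\beta(t)\rangle\big)\Big),$$ where $c,b,s\in\mathbb{R}$, $\epsilon\in\{\pm1\}$, $A\in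 O(n)$ with $AS=SA$, $\beta:\mathbb{R}\to\mathbb{R}^n$ is a solution of $\ddot\beta=S\beta$, and $\langle\cdot,\cdot\rangle$ is the standard Euclidean inner product; here $\phi^*g_S=e^{2s}g_S$. *)

theory Defs
  imports "HOL-Analysis.Analysis"
begin

section \<open>Smooth maps on open subsets of Euclidean spaces\<close>

text \<open>All directional derivatives of order at most \<open>k\<close>, along constant vector fields, exist and
  are continuous; those of order less than \<open>k\<close> are moreover Frechet differentiable.  On an open
  set \<open>U\<close> of a Euclidean space this is the usual notion of being of class \<open>C^k\<close>.\<close>

primrec Ck_on :: "nat \<Rightarrow> 'a::euclidean_space set \<Rightarrow> ('a \<Rightarrow> 'b::real_normed_vector) \<Rightarrow> bool" where
  "Ck_on 0 U f \<longleftrightarrow> continuous_on U f"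
| "Ck_on (Suc k) U f \<longleftrightarrow> (\<forall>p\<in>U. f differentiable (at p)) \<and>
     (\<forall>u. Ck_on k U (\<lambda>p. frechet_derivative f (at p) u))"

definition smooth_on :: "'a::euclidean_space set \<Rightarrow> ('a \<Rightarrow> 'b::real_normed_vector) \<Rightarrow> bool" where
  "smooth_on U f \<longleftrightarrow> (\<forall>k. Ck_on k U f)"

definition diffeo :: "'a::euclidean_space set \<Rightarrow> 'b::euclidean_space set \<Rightarrow> ('a \<Rightarrow> 'b) \<Rightarrow> bool" where
  "diffeo U V \<psi> \<longleftrightarrow> open U \<and> open V \<and> bij_betw \<psi> U V \<and>
     smooth_on U \<psi> \<and> smooth_on V (inv_into U \<psi>)"

section \<open>Semi-Riemannian metrics on open subsets of Euclidean spaces\<close>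

text \<open>Every tangent space is identified with \<open>'a\<close>; \<open>g p u w\<close> is the value of the metric at the
  point \<open>p\<close> on the tangent vectors \<open>u\<close> and \<open>w\<close>.\<close>

type_synonym 'a metric = "'a \<Rightarrow> 'a \<Rightarrow> 'a \<Rightarrow> real"

definition semi_riemannian :: "'a::euclidean_space set \<Rightarrow> 'a metric \<Rightarrow> bool" where
  "semi_riemannian U g \<longleftrightarrow> open U \<and>
     (\<forall>p\<in>U. bilinear (g p) \<and> (\<forall>u w. g p u w = g p w u) \<and>
        (\<forall>u. (\<forall>w. g p u w = 0) \<longrightarrow> u = 0)) \<and>
     (\<forall>u w. smooth_on U (\<lambda>p. g p u w))"

text \<open>\<open>christoffel g p u w\<close> is the covariant derivative at \<open>p\<close> of the constant vector field \<open>w\<close> in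
  direction \<open>u\<close>, for the Levi-Civita connection of \<open>g\<close>; the defining equation is the Koszul formula
  for constant (hence commuting) vector fields.\<close>

definition christoffel :: "'a::euclidean_space metric \<Rightarrow> 'a \<Rightarrow> 'a \<Rightarrow> 'a \<Rightarrow> 'a" where
  "christoffel g p u w = (THE k. \<forall>z. 2 * g p k z =
       frechet_derivative (\<lambda>q. g q w z) (at p) u
     + frechet_derivative (\<lambda>q. g q u z) (at p) w
     - frechet_derivative (\<lambda>q. g q u w) (at p) z)"

text \<open>The Riemann curvature tensor \<open>R(u,w)z = \<nabla>\<^sub>u\<nabla>\<^sub>w z - \<nabla>\<^sub>w\<nabla>\<^sub>u z\<close>, for constant vector fields
  \<open>u\<close>, \<open>w\<close>, \<open>z\<close>.\<close>

definition riemann_curvature :: "'a::euclidean_space metric \<Rightarrow> 'a \<Rightarrow> 'a \<Rightarrow> 'a \<Rightarrow> 'a \<Rightarrow> 'a" where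
  "riemann_curvature g p u w z =
       frechet_derivative (\<lambda>q. christoffel g q w z) (at p) u
     - frechet_derivative (\<lambda>q. christoffel g q u z) (at p) w
     + christoffel g p u (christoffel g p w z)
     - christoffel g p w (christoffel g p u z)"

definition flat_metric :: "'a::euclidean_space set \<Rightarrow> 'a metric \<Rightarrow> bool" where
  "flat_metric U g \<longleftrightarrow> semi_riemannian U g \<and> (\<forall>p\<in>U. \<forall>u w z. riemann_curvature g p u w z = 0)"

definition pullback :: "('a::euclidean_space \<Rightarrow> 'b::euclidean_space) \<Rightarrow> 'b metric \<Rightarrow> 'a metric" where
  "pullback \<psi> h p u w =
     h (\<psi> p) (frechet_derivative \<psi> (at p) u) (frechet_derivative \<psi> (at p) w)"

definition conformal_change :: "('a \<Rightarrow> real) \<Rightarrow> 'a metric \<Rightarrow> 'a metric" where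
  "conformal_change f g p u w = exp (2 * f p) * g p u w"

section \<open>Conformal maps\<close>

definition conformal_diffeo ::
    "'a::euclidean_space set \<Rightarrow> 'a metric \<Rightarrow> 'b::euclidean_space set \<Rightarrow> 'b metric \<Rightarrow> ('a \<Rightarrow> 'b) \<Rightarrow> bool"
  where
  "conformal_diffeo U g V h \<psi> \<longleftrightarrow> diffeo U V \<psi> \<and>
     (\<exists>f. smooth_on U f \<and> (\<forall>p\<in>U. pullback \<psi> h p = conformal_change f g p))"

definition conformal_transformation ::
    "'a::euclidean_space set \<Rightarrow> 'a metric \<Rightarrow> ('a \<Rightarrow> 'a) \<Rightarrow> bool" where
  "conformal_transformation N g \<phi> \<longleftrightarrow> conformal_diffeo N g N g \<phi>"

definition homothety :: "'a::euclidean_space set \<Rightarrow> 'a metric \<Rightarrow> ('a \<Rightarrow> 'a) \<Rightarrow> bool" where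
  "homothety N g \<phi> \<longleftrightarrow> diffeo N N \<phi> \<and>
     (\<exists>s. \<forall>p\<in>N. pullback \<phi> g p = conformal_change (\<lambda>_. s) g p)"

definition isometry :: "'a::euclidean_space set \<Rightarrow> 'a metric \<Rightarrow> ('a \<Rightarrow> 'a) \<Rightarrow> bool" where
  "isometry N g \<phi> \<longleftrightarrow> diffeo N N \<phi> \<and> (\<forall>p\<in>N. pullback \<phi> g p = g p)"

definition essential :: "'a::euclidean_space set \<Rightarrow> 'a metric \<Rightarrow> ('a \<Rightarrow> 'a) \<Rightarrow> bool" where
  "essential N g \<phi> \<longleftrightarrow> conformal_transformation N g \<phi> \<and>
     \<not> (\<exists>h. smooth_on N h \<and> isometry N (conformal_change h g) \<phi>)"

text \<open>A conformal diffeomorphism into a flat manifold is one onto an open subset of it, which is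
  again flat, and which may be shrunk to a coordinate domain.  So it is enough to let the targets
  range over open subsets \<open>V\<close> of \<open>'a\<close> with arbitrary flat metrics.\<close>

definition conformally_flat :: "'a::euclidean_space set \<Rightarrow> 'a metric \<Rightarrow> bool" where
  "conformally_flat N g \<longleftrightarrow>
     (\<forall>p\<in>N. \<exists>U V h (\<psi> :: 'a \<Rightarrow> 'a). p \<in> U \<and> U \<subseteq> N \<and>
        flat_metric V h \<and> conformal_diffeo U g V h \<psi>)"

section \<open>Cahen-Wallach spaces\<close>

text \<open>Points are triples \<open>(t, x, v)\<close>.  The product \<open>2 dv dt\<close> is the symmetric one,
  \<open>dv \<otimes> dt + dt \<otimes> dv\<close>.\<close>

definition cw_metric :: "real^'n^'n \<Rightarrow> (real \<times> (real^'n) \<times> real) metric" where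
  "cw_metric S = (\<lambda>(t, x, v) (t1, x1, v1) (t2, x2, v2).
     (v1 * t2 + t1 * v2) + (x \<bullet> (S *v x)) * (t1 * t2) + x1 \<bullet> x2)"

definition cw_solution :: "real^'n^'n \<Rightarrow> (real \<Rightarrow> real^'n) \<Rightarrow> bool" where
  "cw_solution S \<beta> \<longleftrightarrow> (\<exists>\<beta>'. \<forall>t. (\<beta> has_vector_derivative \<beta>' t) (at t) \<and>
     (\<beta>' has_vector_derivative (S *v \<beta> t)) (at t))"

definition cw_admissible :: "real^'n^'n \<Rightarrow> real \<Rightarrow> (real \<Rightarrow> real^'n) \<Rightarrow> real^'n^'n \<Rightarrow> bool" where
  "cw_admissible S \<epsilon> \<beta> A \<longleftrightarrow>
     \<epsilon> \<in> {1, -1} \<and> cw_solution S \<beta> \<and> orthogonal_matrix A \<and> A ** S = S ** A"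

definition cw_map ::
    "real \<Rightarrow> real \<Rightarrow> real \<Rightarrow> (real \<Rightarrow> real^'n) \<Rightarrow> real^'n^'n \<Rightarrow> real \<Rightarrow>
      real \<times> (real^'n) \<times> real \<Rightarrow> real \<times> (real^'n) \<times> real"
  where
  "cw_map c \<epsilon> b \<beta> A s = (\<lambda>(t, x, v).
     (\<epsilon> * t + c,
      exp s *\<^sub>R (A *v x) + \<beta> t,
      \<epsilon> * (exp (2 * s) * v + b
        - vector_derivative \<beta> (at t) \<bullet> (exp s *\<^sub>R (A *v x) + (1/2) *\<^sub>R \<beta> t))))"

end

(*
  A conformal transformation phi with phi^* g = e^(2f) g carries the Levi-Civita connection of g to
  that of e^(2f) g.  For a null vector a and b orthogonal to a, the number R(a,b,a,b) therefore
  changes, up to the factor e^(2f), only by a multiple of g(b,b) that does not depend on b.  For a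
  Cahen-Wallach metric R(a,b,a,b) is the quadratic form S evaluated at t_a x_b - t_b x_a.  If S is
  not a multiple of the identity, this forces d phi to preserve the line of d/dv and to map dt to
  a multiple of itself, and comparing the spread of S on unit spheres makes the multiple +1 or -1.
  Differentiating the conformal relation along d/dv then gives df = 0, so phi is affine for the
  Levi-Civita connection and can be integrated explicitly.  If S is a multiple of the identity, the
  space is conformally flat.

  A homothety of factor e^(2s), s nonzero, is essential as soon as it has a fixed point p, because
  every conformal change takes the same value at p and phi(p).  If epsilon = 1 and c is nonzero,
  h = - s t / c decreases by s along phi, so phi is an isometry of e^(2h) g.
*)
theory Submission
  imports Defs
begin

section \<open>Second derivatives and smoothness\<close>

text \<open>The curvature test is confined to a null vector \<open>a\<close> because the conformal
  change of R(b,a,a,b) then carries a single unknown number k, namely (df a)^2 minus the Hessian of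
  \<open>f\<close> at (a,a). No equation for \<open>f\<close> has to be solved: for a = d/dv a bad
  image would make \<open>S\<close> scalar whatever k is, and for a null lift of d/dt the gap
  between the largest and the smallest value of \<open>S\<close> on the unit sphere is free of k.
  This is why extrema on spheres are compared, instead of traces or eigenvalues. Failure of
  conformal flatness enters by contraposition: if \<open>S\<close> is \<open>\<mu>\<close> times the
  identity, a flat metric conformal to \<open>g_S\<close> is exhibited near every point. For
  \<open>\<mu> < 0\<close> the rescaling used blows up in finite time, so it is chosen separately
  around each point. A homothety comes with some unnamed factor. Before the fixed point argument can
  start, that factor has to be identified with the parameter \<open>s\<close> of
  \<open>cw_map\<close>.\<close>

lemma second_difference_mvt:
  fixes f :: "'a::euclidean_space \<Rightarrow> real"
  assumes D: "\<And>p. (f has_derivative D p) (at p)"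
    and D2: "\<And>p u. ((\<lambda>p. D p u) has_derivative (\<lambda>z. D2 p z u)) (at p)"
    and r: "0 < r"
  shows "\<exists>s\<in>{0..r}. \<exists>t\<in>{0..r}.
    f (p + r *\<^sub>R u + r *\<^sub>R w) - f (p + r *\<^sub>R u) - f (p + r *\<^sub>R w) + f p
      = r * r * D2 (p + s *\<^sub>R u + t *\<^sub>R w) w u"
proof -
  have lin: "linear (D q)" "linear (\<lambda>z. D2 q z v)" for q v
    using D D2 has_derivative_linear by blast+
  \<comment> \<open>The increment of \<open>f\<close> in direction \<open>w\<close>, as a function
    of the position along \<open>u\<close>. The mean value theorem for \<open>g\<close>, and then
    for \<open>k\<close>, differentiates first along \<open>u\<close> and then along
    \<open>w\<close>.\<close>
  define g where "g s = f (p + s *\<^sub>R u + r *\<^sub>R w) - f (p + s *\<^sub>R u)" for s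
  have g': "(g has_derivative (\<lambda>h. h * (D (p + s *\<^sub>R u + r *\<^sub>R w) u - D (p + s *\<^sub>R u) u)))
      (at s within {0..r})" for s
    unfolding g_def
    by (rule derivative_eq_intros has_derivative_compose[OF _ D] refl)+
       (auto simp: linear_cmul[OF lin(1)] algebra_simps)
  obtain s where s: "s \<in> {0<..<r}"
    "g r - g 0 = (r - 0) * (D (p + s *\<^sub>R u + r *\<^sub>R w) u - D (p + s *\<^sub>R u) u)"
    using mvt_simple[OF r g'] by blast
  define k where "k t = D (p + s *\<^sub>R u + t *\<^sub>R w) u" for t
  have k': "(k has_derivative (\<lambda>h. h * D2 (p + s *\<^sub>R u + t *\<^sub>R w) w u)) (at t within {0..r})" for t
    unfolding k_def
    by (rule has_derivative_eq_rhs, rule has_derivative_compose[where g = "\<lambda>q. D q u", OF _ D2])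
       (rule derivative_eq_intros refl | auto simp: linear_cmul[OF lin(2)])+
  obtain t where t: "t \<in> {0<..<r}" "k r - k 0 = (r - 0) * D2 (p + s *\<^sub>R u + t *\<^sub>R w) w u"
    using mvt_simple[OF r k'] by blast
  have "f (p + r *\<^sub>R u + r *\<^sub>R w) - f (p + r *\<^sub>R u) - f (p + r *\<^sub>R w) + f p = g r - g 0"
    by (simp add: g_def)
  also have "\<dots> = r * (k r - k 0)" using s by (simp add: k_def)
  also have "\<dots> = r * r * D2 (p + s *\<^sub>R u + t *\<^sub>R w) w u" using t by simp
  finally show ?thesis using s t by (meson greaterThanLessThan_subseteq_atLeastAtMost_iff order_refl subsetD)
qed

text \<open>The second difference over a small parallelogram does not change when its sides
  \<open>u\<close> and \<open>w\<close> are exchanged. Expressed by the mean value theorem in both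
  ways and divided by the square of the scale, it tends to either mixed derivative by
  continuity.\<close>

lemma second_derivative_symmetric_real:
  fixes f :: "'a::euclidean_space \<Rightarrow> real"
  assumes D: "\<And>p. (f has_derivative D p) (at p)"
    and D2: "\<And>p u. ((\<lambda>p. D p u) has_derivative (\<lambda>z. D2 p z u)) (at p)"
    and cont: "\<And>z u. continuous_on UNIV (\<lambda>p. D2 p z u)"
  shows "D2 p u w = D2 p w u"
proof -
  define r where "r n = inverse (real (Suc n))" for n
  have r: "r n > 0" "r \<longlonglongrightarrow> 0" for n
    unfolding r_def using LIMSEQ_inverse_real_of_nat by auto
  have "\<exists>s\<in>{0..r n}. \<exists>t\<in>{0..r n}. \<exists>s'\<in>{0..r n}. \<exists>t'\<in>{0..r n}.
      D2 (p + s *\<^sub>R u + t *\<^sub>R w) w u = D2 (p + s' *\<^sub>R w + t' *\<^sub>R u) u w" for n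
  proof -
    obtain s t where st: "s \<in> {0..r n}" "t \<in> {0..r n}"
      "f (p + r n *\<^sub>R u + r n *\<^sub>R w) - f (p + r n *\<^sub>R u) - f (p + r n *\<^sub>R w) + f p
        = r n * r n * D2 (p + s *\<^sub>R u + t *\<^sub>R w) w u"
      using second_difference_mvt[OF D D2 r(1)] by meson
    obtain s' t' where st': "s' \<in> {0..r n}" "t' \<in> {0..r n}"
      "f (p + r n *\<^sub>R w + r n *\<^sub>R u) - f (p + r n *\<^sub>R w) - f (p + r n *\<^sub>R u) + f p
        = r n * r n * D2 (p + s' *\<^sub>R w + t' *\<^sub>R u) u w"
      using second_difference_mvt[OF D D2 r(1)] by meson
    have "r n * r n * D2 (p + s *\<^sub>R u + t *\<^sub>R w) w u = r n * r n * D2 (p + s' *\<^sub>R w + t' *\<^sub>R u) u w"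
      unfolding st(3)[symmetric] st'(3)[symmetric] by (simp add: algebra_simps)
    hence "D2 (p + s *\<^sub>R u + t *\<^sub>R w) w u = D2 (p + s' *\<^sub>R w + t' *\<^sub>R u) u w"
      using r(1)[of n] by simp
    thus ?thesis using st st' by blast
  qed
  then obtain s t s' t' where st: "\<And>n. s n \<in> {0..r n}" "\<And>n. t n \<in> {0..r n}"
     "\<And>n. s' n \<in> {0..r n}" "\<And>n. t' n \<in> {0..r n}"
     and eq: "\<And>n. D2 (p + s n *\<^sub>R u + t n *\<^sub>R w) w u = D2 (p + s' n *\<^sub>R w + t' n *\<^sub>R u) u w"
    by metis
  have lim: "a \<longlonglongrightarrow> 0" if "\<And>n. a n \<in> {0..r n}" for a
    by (rule tendsto_sandwich[OF _ _ tendsto_const r(2)]) (use that in auto)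
  have iso: "isCont (\<lambda>p. D2 p z v) p" for z v
    using cont continuous_on_eq_continuous_at open_UNIV by blast
  have 1: "(\<lambda>n. p + s n *\<^sub>R u + t n *\<^sub>R w) \<longlonglongrightarrow> p + 0 *\<^sub>R u + 0 *\<^sub>R w"
    "(\<lambda>n. p + s' n *\<^sub>R w + t' n *\<^sub>R u) \<longlonglongrightarrow> p + 0 *\<^sub>R w + 0 *\<^sub>R u"
    by (intro tendsto_intros lim st)+
  have "(\<lambda>n. D2 (p + s n *\<^sub>R u + t n *\<^sub>R w) w u) \<longlonglongrightarrow> D2 p w u"
    using isCont_tendsto_compose[OF iso] 1(1) by simp
  moreover have "(\<lambda>n. D2 (p + s' n *\<^sub>R w + t' n *\<^sub>R u) u w) \<longlonglongrightarrow> D2 p u w"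
    using isCont_tendsto_compose[OF iso] 1(2) by simp
  ultimately show ?thesis unfolding eq using LIMSEQ_unique by blast
qed

lemma second_derivative_symmetric:
  fixes f :: "'a::euclidean_space \<Rightarrow> 'b::euclidean_space"
  assumes D: "\<And>p. (f has_derivative D p) (at p)"
    and D2: "\<And>p u. ((\<lambda>p. D p u) has_derivative (\<lambda>z. D2 p z u)) (at p)"
    and cont: "\<And>z u. continuous_on UNIV (\<lambda>p. D2 p z u)"
  shows "D2 p u w = D2 p w u"
proof (rule euclidean_eqI)
  fix i :: 'b
  show "D2 p u w \<bullet> i = D2 p w u \<bullet> i"
    by (rule second_derivative_symmetric_real[where f = "\<lambda>p. f p \<bullet> i" and D = "\<lambda>p u. D p u \<bullet> i"])
       (intro derivative_intros continuous_intros D D2 cont)+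
qed

section \<open>Closure properties of the classes C^k\<close>

lemma Ck_on_cong:
  assumes "open U" "\<And>p. p \<in> U \<Longrightarrow> f p = g p" "Ck_on k U f"
  shows "Ck_on k U g"
  using assms(2,3)
proof (induction k arbitrary: f g)
  case 0
  thus ?case using continuous_on_eq by (auto intro: continuous_on_eq)
next
  case (Suc k)
  have d: "f differentiable (at p)" if "p \<in> U" for p using Suc.prems that by simp
  have fr: "frechet_derivative f (at p) = frechet_derivative g (at p)" if "p \<in> U" for p
    using frechet_derivative_transform_within_open[OF d[OF that] assms(1) that] Suc.prems by blast
  have dg: "g differentiable (at p)" if p: "p \<in> U" for p
  proof -
    have "(f has_derivative frechet_derivative f (at p)) (at p)"
      using d[OF p] frechet_derivative_works by blast
    hence "(g has_derivative frechet_derivative f (at p)) (at p)"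
      by (rule has_derivative_transform_within_open[OF _ assms(1) p]) (use Suc.prems in auto)
    thus ?thesis by (auto simp: differentiable_def)
  qed
  have "Ck_on k U (\<lambda>p. frechet_derivative g (at p) u)" for u
    by (rule Suc.IH[of "\<lambda>p. frechet_derivative f (at p) u"]) (use fr Suc.prems in auto)
  thus ?case using dg by simp
qed

text \<open>On an open set derivatives are unique, so an explicit formula \<open>f'\<close> may
  stand for \<open>frechet_derivative\<close>. This turns the later smoothness proofs into
  inductions on \<open>k\<close>.\<close>

lemma Ck_on_SucI:
  assumes "open U" "\<And>p. p \<in> U \<Longrightarrow> (f has_derivative f' p) (at p)" "\<And>u. Ck_on k U (\<lambda>p. f' p u)"
  shows "Ck_on (Suc k) U f"
proof -
  have "f differentiable (at p)" if "p \<in> U" for p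
    using assms(2)[OF that] by (auto simp: differentiable_def)
  moreover have "f' p u = frechet_derivative f (at p) u" if "p \<in> U" for p u
    using frechet_derivative_at[OF assms(2)[OF that]] by simp
  ultimately show ?thesis using Ck_on_cong[OF assms(1) _ assms(3)] by auto
qed

lemma Ck_on_SucD:
  assumes "Ck_on (Suc k) U f" "p \<in> U"
  shows "(f has_derivative frechet_derivative f (at p)) (at p)"
  using assms frechet_derivative_works by auto

lemma Ck_on_Suc_le: "Ck_on (Suc k) U f \<Longrightarrow> Ck_on k U f"
proof (induction k arbitrary: f)
  case 0
  thus ?case
    by (auto intro!: continuous_at_imp_continuous_on differentiable_imp_continuous_within)
next
  case (Suc k)
  from Suc.prems show ?case by (auto intro: Suc.IH simp del: Ck_on.simps(2) simp: Ck_on.simps(2)[of "Suc k"] Ck_on.simps(2)[of k U f])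
qed

lemma Ck_on_const: "open U \<Longrightarrow> Ck_on k U (\<lambda>p. c)"
  by (induction k arbitrary: c) auto

lemma Ck_on_bounded_linear:
  assumes "open U" "bounded_linear f"
  shows "Ck_on k U f"
proof (cases k)
  case 0
  thus ?thesis using assms by (simp add: linear_continuous_on)
next
  case (Suc j)
  thus ?thesis
    using Ck_on_SucI[OF assms(1) bounded_linear_imp_has_derivative[OF assms(2)] Ck_on_const[OF assms(1)]]
    by simp
qed

lemma Ck_on_add:
  assumes "open U"
  shows "Ck_on k U f \<Longrightarrow> Ck_on k U g \<Longrightarrow> Ck_on k U (\<lambda>p. f p + g p)"
proof (induction k arbitrary: f g)
  case 0
  thus ?case by (auto intro: continuous_intros)
next
  case (Suc k)
  show ?case
    by (rule Ck_on_SucI[OF assms], rule has_derivative_add; (rule Ck_on_SucD Suc.IH)?)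
       (use Suc.prems in auto)
qed

lemma Ck_on_mult:
  fixes f g :: "'a::euclidean_space \<Rightarrow> real"
  assumes "open U"
  shows "Ck_on k U f \<Longrightarrow> Ck_on k U g \<Longrightarrow> Ck_on k U (\<lambda>p. f p * g p)"
proof (induction k arbitrary: f g)
  case 0
  thus ?case by (auto intro: continuous_intros)
next
  case (Suc k)
  have "Ck_on k U f" "Ck_on k U g" using Suc.prems Ck_on_Suc_le by blast+
  hence *: "Ck_on k U (\<lambda>p. f p * frechet_derivative g (at p) u + frechet_derivative f (at p) u * g p)" for u
    using Suc.prems by (intro Ck_on_add[OF assms] Suc.IH) auto
  show ?case
    by (rule Ck_on_SucI[where f' = "\<lambda>p u. f p * frechet_derivative g (at p) u
          + frechet_derivative f (at p) u * g p", OF assms has_derivative_mult *])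
       (use Suc.prems Ck_on_SucD in blast)+
qed

lemma Ck_on_exp:
  fixes f :: "'a::euclidean_space \<Rightarrow> real"
  assumes "open U"
  shows "Ck_on k U f \<Longrightarrow> Ck_on k U (\<lambda>p. exp (f p))"
proof (induction k)
  case 0
  thus ?case by (auto intro: continuous_intros)
next
  case (Suc k)
  have "Ck_on k U (\<lambda>p. exp (f p))" using Suc Ck_on_Suc_le by blast
  hence *: "Ck_on k U (\<lambda>p. frechet_derivative f (at p) u * exp (f p))" for u
    using Suc.prems by (intro Ck_on_mult[OF assms]) auto
  show ?case
    by (rule Ck_on_SucI[where f' = "\<lambda>p u. frechet_derivative f (at p) u * exp (f p)", OF assms _ *])
       (rule derivative_eq_intros Ck_on_SucD[OF Suc.prems] | simp)+
qed

section \<open>Derivatives of linear and bilinear families\<close>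

lemma linear_expansion:
  fixes f :: "'a::euclidean_space \<Rightarrow> 'b::real_normed_vector"
  assumes "linear f"
  shows "f v = (\<Sum>i\<in>Basis. (v \<bullet> i) *\<^sub>R f i)"
proof -
  have "f v = f (\<Sum>i\<in>Basis. (v \<bullet> i) *\<^sub>R i)" by (simp add: euclidean_representation)
  thus ?thesis by (simp add: linear_sum[OF assms] linear_cmul[OF assms])
qed

lemma bilinear_expansion:
  fixes B :: "'b::euclidean_space \<Rightarrow> 'c::euclidean_space \<Rightarrow> 'd::real_normed_vector"
  assumes "bilinear B"
  shows "B u w = (\<Sum>i\<in>Basis. \<Sum>j\<in>Basis. ((u \<bullet> i) * (w \<bullet> j)) *\<^sub>R B i j)"
proof -
  have l: "linear (\<lambda>u. B u w)" "linear (B u)" for u w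
    using assms by (auto simp: bilinear_def)
  have "B u w = (\<Sum>i\<in>Basis. (u \<bullet> i) *\<^sub>R B i w)" by (rule linear_expansion[OF l(1)])
  also have "\<dots> = (\<Sum>i\<in>Basis. (u \<bullet> i) *\<^sub>R (\<Sum>j\<in>Basis. (w \<bullet> j) *\<^sub>R B i j))"
    by (intro sum.cong refl arg_cong2[of _ _ _ _ scaleR] linear_expansion[OF l(2)])
  finally show ?thesis by (simp add: scaleR_sum_right)
qed

text \<open>Additivity and homogeneity pass from \<open>B q\<close> to \<open>dB z\<close> because
  both sides of each identity are derivatives of one and the same function of
  \<open>q\<close>.\<close>

lemma bilinear_derivative:
  fixes B :: "'a::real_normed_vector \<Rightarrow> 'b::euclidean_space \<Rightarrow> 'c::euclidean_space \<Rightarrow> 'd::real_normed_vector"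
  assumes dB: "\<And>u w. ((\<lambda>q. B q u w) has_derivative (\<lambda>z. dB z u w)) (at q)"
    and bil: "\<And>q. bilinear (B q)"
  shows "bilinear (dB z)"
proof -
  note l = bil[unfolded bilinear_def, rule_format]
  have l': "linear (\<lambda>u. B q u w)" "linear (B q u)" for q u w using l by auto
  have 1: "(\<lambda>z. dB z (u + u') w) = (\<lambda>z. dB z u w + dB z u' w)"
       "(\<lambda>z. dB z u (w + w')) = (\<lambda>z. dB z u w + dB z u w')"
       "(\<lambda>z. dB z (c *\<^sub>R u) w) = (\<lambda>z. c *\<^sub>R dB z u w)"
       "(\<lambda>z. dB z u (c *\<^sub>R w)) = (\<lambda>z. c *\<^sub>R dB z u w)" for u u' w w' c
    using has_derivative_unique[OF dB[of "u + u'" w]] has_derivative_unique[OF dB[of u "w + w'"]]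
      has_derivative_unique[OF dB[of "c *\<^sub>R u" w]] has_derivative_unique[OF dB[of u "c *\<^sub>R w"]]
      has_derivative_add[OF dB[of u w] dB[of u' w]] has_derivative_add[OF dB[of u w] dB[of u w']]
      has_derivative_scaleR_right[OF dB[of u w], of c]
    by (simp_all add: linear_add[OF l'(1)] linear_add[OF l'(2)] linear_cmul[OF l'(1)] linear_cmul[OF l'(2)])
  show ?thesis unfolding bilinear_def by (auto intro!: linearI simp: fun_cong[OF 1(1)] fun_cong[OF 1(2)] fun_cong[OF 1(3)] fun_cong[OF 1(4)])
qed

text \<open>The derivative of \<open>B\<close> is given with its two arguments frozen. Expanding in
  bases writes the composite as a finite sum of products of differentiable functions, to which the
  product rule applies.\<close>

lemma has_derivative_bilinear_family:
  fixes B :: "'a::real_normed_vector \<Rightarrow> 'b::euclidean_space \<Rightarrow> 'c::euclidean_space \<Rightarrow> 'd::real_normed_vector"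
  assumes dB: "\<And>u w. ((\<lambda>q. B q u w) has_derivative (\<lambda>z. dB z u w)) (at (\<phi> p))"
    and bil: "\<And>q. bilinear (B q)"
    and \<phi>: "(\<phi> has_derivative \<phi>') (at p)" and a: "(a has_derivative a') (at p)"
    and b: "(b has_derivative b') (at p)"
  shows "((\<lambda>q. B (\<phi> q) (a q) (b q)) has_derivative
    (\<lambda>z. dB (\<phi>' z) (a p) (b p) + B (\<phi> p) (a' z) (b p) + B (\<phi> p) (a p) (b' z))) (at p)"
proof -
  have bd: "bilinear (dB z)" for z using bilinear_derivative[OF dB bil] .
  have 1: "((\<lambda>q. B (\<phi> q) i j) has_derivative (\<lambda>z. dB (\<phi>' z) i j)) (at p)" for i j
    using has_derivative_compose[OF \<phi> dB] .
  show ?thesis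
    apply (subst bilinear_expansion[OF bil])
    apply (rule has_derivative_eq_rhs)
     apply (rule derivative_intros a b 1)+
    apply (rule ext)
    apply (subst bilinear_expansion[OF bd, of _ "a p" "b p"])
    apply (subst (2 3) bilinear_expansion[OF bil])
    apply (simp add: sum.distrib[symmetric] algebra_simps)
    done
qed

section \<open>Curvature under conformal maps\<close>

text \<open>\<open>L\<close>, \<open>H\<close>, \<open>T\<close> are the first three derivatives of
  \<open>\<phi>\<close>, the most recent direction being the first argument after the point;
  \<open>G\<close> is the gradient of \<open>f\<close>. With a name for every derivative, the
  comparison of curvatures becomes algebra at one point.\<close>

locale conformal_jet =
  fixes g :: "'a::euclidean_space metric" and dg :: "'a \<Rightarrow> 'a metric"
    and \<Gamma> :: "'a \<Rightarrow> 'a \<Rightarrow> 'a \<Rightarrow> 'a" and d\<Gamma> :: "'a \<Rightarrow> 'a \<Rightarrow> 'a \<Rightarrow> 'a \<Rightarrow> 'a"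
    and \<phi> :: "'a \<Rightarrow> 'a" and L :: "'a \<Rightarrow> 'a \<Rightarrow> 'a" and H :: "'a \<Rightarrow> 'a \<Rightarrow> 'a \<Rightarrow> 'a"
    and T :: "'a \<Rightarrow> 'a \<Rightarrow> 'a \<Rightarrow> 'a \<Rightarrow> 'a"
    and f :: "'a \<Rightarrow> real" and df :: "'a \<Rightarrow> 'a \<Rightarrow> real" and ddf :: "'a \<Rightarrow> 'a \<Rightarrow> 'a \<Rightarrow> real"
    and G :: "'a \<Rightarrow> 'a" and dG :: "'a \<Rightarrow> 'a \<Rightarrow> 'a"
  assumes g_bil: "bilinear (g p)" and g_sym: "g p u w = g p w u"
    and g_nondeg: "(\<And>w. g p u w = 0) \<Longrightarrow> u = 0"
    and g_deriv: "((\<lambda>q. g q u w) has_derivative (\<lambda>z. dg p z u w)) (at p)"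
    and \<Gamma>_bil: "bilinear (\<Gamma> p)" and \<Gamma>_sym: "\<Gamma> p u w = \<Gamma> p w u"
    and \<Gamma>_deriv: "((\<lambda>q. \<Gamma> q u w) has_derivative (\<lambda>z. d\<Gamma> p z u w)) (at p)"
    and koszul: "2 * g p (\<Gamma> p u w) z = dg p u w z + dg p w u z - dg p z u w"
    and \<phi>_deriv: "(\<phi> has_derivative L p) (at p)"
    and L_deriv: "((\<lambda>q. L q u) has_derivative (\<lambda>z. H p z u)) (at p)"
    and H_deriv: "((\<lambda>q. H q z u) has_derivative (\<lambda>y. T p y z u)) (at p)"
    and H_sym: "H p z u = H p u z" and T_sym: "T p y z u = T p z y u"
    and f_deriv: "(f has_derivative df p) (at p)"
    and df_deriv: "((\<lambda>q. df q u) has_derivative (\<lambda>z. ddf p z u)) (at p)"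
    and G_grad: "g p (G p) z = df p z" and G_deriv: "(G has_derivative dG p) (at p)"
    and conformal: "g (\<phi> p) (L p u) (L p w) = exp (2 * f p) * g p u w"
begin

lemmas g_lin = bilinear_ladd[OF g_bil] bilinear_radd[OF g_bil] bilinear_lsub[OF g_bil]
  bilinear_rsub[OF g_bil] bilinear_lmul[OF g_bil] bilinear_rmul[OF g_bil]
  bilinear_lneg[OF g_bil] bilinear_rneg[OF g_bil] bilinear_lzero[OF g_bil] bilinear_rzero[OF g_bil]

lemmas \<Gamma>_lin = bilinear_ladd[OF \<Gamma>_bil] bilinear_radd[OF \<Gamma>_bil] bilinear_lsub[OF \<Gamma>_bil]
  bilinear_rsub[OF \<Gamma>_bil] bilinear_lmul[OF \<Gamma>_bil] bilinear_rmul[OF \<Gamma>_bil]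

lemma linear_L: "linear (L p)" using \<phi>_deriv has_derivative_linear by blast
lemma linear_df: "linear (df p)" using f_deriv has_derivative_linear by blast
lemma linear_H: "linear (\<lambda>z. H p z u)" "linear (H p u)"
  using L_deriv has_derivative_linear by (blast, metis (no_types) H_sym ext)

lemmas L_lin = linear_add[OF linear_L] linear_diff[OF linear_L] linear_cmul[OF linear_L]
lemmas df_lin = linear_add[OF linear_df] linear_diff[OF linear_df] linear_cmul[OF linear_df]

lemma dg_sym: "dg p z u w = dg p z w u"
  using has_derivative_unique[OF g_deriv[of u w p] g_deriv[of w u p, unfolded g_sym[of _ w u]]] by meson

text \<open>Compatibility of the connection with the metric: in the sum of two instances of the
  Koszul formula all terms but \<open>dg p z u w\<close> cancel.\<close>

lemma dg_\<Gamma>: "dg p z u w = g p (\<Gamma> p z u) w + g p u (\<Gamma> p z w)"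
  using koszul[of p z u w] koszul[of p z w u] dg_sym[of p z u w] dg_sym[of p u z w] dg_sym[of p w u z]
    g_sym[of p u "\<Gamma> p z w"] by simp

text \<open>Nondegeneracy makes \<open>L p\<close> injective. Surjectivity then allows a vector at
  \<open>\<phi> p\<close> to be tested against vectors \<open>L p z\<close> alone.\<close>

lemma surj_L: "surj (L p)"
proof (rule linear_inj_imp_surj[OF linear_L])
  show "inj (L p)"
  proof (subst linear_injective_0[OF linear_L], safe)
    fix u assume "L p u = 0"
    hence "exp (2 * f p) * g p u w = 0" for w using conformal[of p u w] by (simp add: g_lin)
    hence "g p u w = 0" for w by simp
    thus "u = 0" by (rule g_nondeg)
  qed
qed

lemma conformal_deriv:
  "dg (\<phi> p) (L p z) (L p u) (L p w) + g (\<phi> p) (H p z u) (L p w) + g (\<phi> p) (L p u) (H p z w)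
    = exp (2 * f p) * (2 * df p z * g p u w + dg p z u w)"
proof -
  have 1: "((\<lambda>q. g (\<phi> q) (L q u) (L q w)) has_derivative (\<lambda>z. dg (\<phi> p) (L p z) (L p u) (L p w)
      + g (\<phi> p) (H p z u) (L p w) + g (\<phi> p) (L p u) (H p z w))) (at p)"
    by (rule has_derivative_bilinear_family[OF g_deriv g_bil \<phi>_deriv L_deriv L_deriv])
  have 2: "((\<lambda>q. exp (2 * f q) * g q u w) has_derivative
      (\<lambda>z. exp (2 * f p) * (2 * df p z * g p u w + dg p z u w))) (at p)"
    by (rule derivative_eq_intros f_deriv g_deriv refl)+ (simp add: algebra_simps)
  show ?thesis
    using fun_cong[OF has_derivative_unique[OF 1[unfolded conformal] 2]] by simp
qed

text \<open>The Levi-Civita connection of exp(2f) g on constant vector fields.\<close>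

definition C :: "'a \<Rightarrow> 'a \<Rightarrow> 'a \<Rightarrow> 'a" where
  "C p u w = \<Gamma> p u w + df p u *\<^sub>R w + df p w *\<^sub>R u - g p u w *\<^sub>R G p"

text \<open>The derivative of the conformal relation is combined over the three arguments as in the
  Koszul formula. Symmetry of \<open>H\<close> cancels every second derivative except
  \<open>H p u w\<close>, and the pairing with all \<open>L p z\<close> determines the
  vector.\<close>

lemma connection_relation: "H p u w + \<Gamma> (\<phi> p) (L p u) (L p w) = L p (C p u w)"
proof -
  have "g (\<phi> p) (H p u w + \<Gamma> (\<phi> p) (L p u) (L p w) - L p (C p u w)) (L p z) = 0" for z
  proof -
    have "2 * g (\<phi> p) (H p u w + \<Gamma> (\<phi> p) (L p u) (L p w)) (L p z)
      = exp (2 * f p) * (2 * df p u * g p w z + 2 * df p w * g p u z - 2 * df p z * g p u w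
          + 2 * g p (\<Gamma> p u w) z)"
      using koszul[of "\<phi> p" "L p u" "L p w" "L p z"]
        conformal_deriv[of p u w z] conformal_deriv[of p w u z] conformal_deriv[of p z u w]
      unfolding H_sym[of p z] H_sym[of p w u] g_sym[of "\<phi> p" "L p u"] g_sym[of "\<phi> p" "L p w"]
        koszul g_lin distrib_left right_diff_distrib
      by linarith
    also have "\<dots> = 2 * (exp (2 * f p) * g p (C p u w) z)"
      unfolding C_def by (simp add: g_lin G_grad algebra_simps)
    finally show ?thesis by (simp add: g_lin conformal)
  qed
  hence "H p u w + \<Gamma> (\<phi> p) (L p u) (L p w) - L p (C p u w) = 0"
    by (intro g_nondeg[of "\<phi> p"]) (metis surj_L surjD)
  thus ?thesis by simp
qed

definition dC :: "'a \<Rightarrow> 'a \<Rightarrow> 'a \<Rightarrow> 'a \<Rightarrow> 'a" where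
  "dC p z u w = d\<Gamma> p z u w + ddf p z u *\<^sub>R w + ddf p z w *\<^sub>R u - dg p z u w *\<^sub>R G p - g p u w *\<^sub>R dG p z"

lemma C_deriv: "((\<lambda>q. C q u w) has_derivative (\<lambda>z. dC p z u w)) (at p)"
  unfolding C_def dC_def
  by (rule derivative_eq_intros \<Gamma>_deriv df_deriv g_deriv G_deriv refl)+ (simp add: algebra_simps)

definition curv :: "'a \<Rightarrow> 'a \<Rightarrow> 'a \<Rightarrow> 'a \<Rightarrow> 'a" where
  "curv p z u w = d\<Gamma> p z u w - d\<Gamma> p u z w + \<Gamma> p z (\<Gamma> p u w) - \<Gamma> p u (\<Gamma> p z w)"

text \<open>Differentiating \<open>connection_relation\<close> once more brings in \<open>T\<close>.
  Antisymmetrising in \<open>z\<close> and \<open>u\<close> removes it, and the remaining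
  \<open>H\<close> are eliminated by \<open>connection_relation\<close> itself.\<close>

lemma curvature_naturality:
  "curv (\<phi> p) (L p z) (L p u) (L p w)
    = L p (dC p z u w - dC p u z w + C p z (C p u w) - C p u (C p z w))"
proof -
  have T: "T p y u w + (d\<Gamma> (\<phi> p) (L p y) (L p u) (L p w) + \<Gamma> (\<phi> p) (H p y u) (L p w)
      + \<Gamma> (\<phi> p) (L p u) (H p y w)) = H p y (C p u w) + L p (dC p y u w)" for y u w
  proof -
    have 1: "((\<lambda>q. H q u w + \<Gamma> (\<phi> q) (L q u) (L q w)) has_derivative
       (\<lambda>y. T p y u w + (d\<Gamma> (\<phi> p) (L p y) (L p u) (L p w) + \<Gamma> (\<phi> p) (H p y u) (L p w)
         + \<Gamma> (\<phi> p) (L p u) (H p y w)))) (at p)"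
      by (intro has_derivative_add H_deriv
          has_derivative_bilinear_family[OF \<Gamma>_deriv \<Gamma>_bil \<phi>_deriv L_deriv L_deriv])
    \<comment> \<open>In \<open>L q (C q u w)\<close> the map and its argument both vary with
      \<open>q\<close>, so the product rule is applied in a basis.\<close>
    note L2 = linear_expansion[OF linear_L] and H2 = linear_expansion[OF linear_H(2)]
    have "((\<lambda>q. \<Sum>i\<in>Basis. (C q u w \<bullet> i) *\<^sub>R L q i) has_derivative
       (\<lambda>y. \<Sum>i\<in>Basis. (C p u w \<bullet> i) *\<^sub>R H p y i + (dC p y u w \<bullet> i) *\<^sub>R L p i)) (at p)"
      by (rule derivative_eq_intros C_deriv L_deriv refl)+
    hence 2: "((\<lambda>q. L q (C q u w)) has_derivative (\<lambda>y. H p y (C p u w) + L p (dC p y u w))) (at p)"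
      by (simp add: L2[of _ "C _ _ _"] L2[of _ "dC _ _ _ _"] H2[of _ _ "C _ _ _"] sum.distrib)
    show ?thesis
      using fun_cong[OF has_derivative_unique[OF 1[unfolded connection_relation] 2]] by simp
  qed
  have H: "H p u w = L p (C p u w) - \<Gamma> (\<phi> p) (L p u) (L p w)" for u w
    using connection_relation[of p u w] by (simp add: algebra_simps)
  have "curv (\<phi> p) (L p z) (L p u) (L p w) \<bullet> i
    = L p (dC p z u w - dC p u z w + C p z (C p u w) - C p u (C p z w)) \<bullet> i" for i
    using arg_cong[OF T[of z u w], of "\<lambda>x. x \<bullet> i"] arg_cong[OF T[of u z w], of "\<lambda>x. x \<bullet> i"]
    unfolding curv_def T_sym[of p z u w] H_sym[of p z u] H[of z "C p u w"] H[of u "C p z w"]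
      H[of z w] H[of u w] L_lin \<Gamma>_lin inner_add_left inner_diff_left
    by linarith
  thus ?thesis by (rule euclidean_eqI)
qed

text \<open>The two hypotheses remove the gradient from \<open>C p a a\<close> and
  \<open>C p b a\<close>, hence every term with the squared length of the gradient. What multiplies
  \<open>g p b b\<close> is (df a)^2 minus the covariant Hessian of \<open>f\<close> at
  (a,a).\<close>

lemma sectional_relation:
  assumes a: "g p a a = 0" and b: "g p a b = 0"
  shows "g (\<phi> p) (curv (\<phi> p) (L p b) (L p a) (L p a)) (L p b)
    = exp (2 * f p) * (g p (curv p b a a) b + (df p (\<Gamma> p a a) + (df p a)\<^sup>2 - ddf p a a) * g p b b)"
proof -
  have b': "g p b a = 0" using b g_sym by metis
  have "g p (dC p b a a - dC p a b a + C p b (C p a a) - C p a (C p b a)) b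
    = g p (curv p b a a) b + (df p (\<Gamma> p a a) + (df p a)\<^sup>2 - ddf p a a) * g p b b"
    unfolding curv_def dC_def C_def
    by (simp add: g_lin \<Gamma>_lin df_lin a b b' G_grad dg_\<Gamma> g_sym[of p _ "\<Gamma> p _ _"] \<Gamma>_sym[of p b a]
        power2_eq_square algebra_simps)
  thus ?thesis unfolding curvature_naturality conformal by simp
qed

end

section \<open>Conformally flat Cahen-Wallach spaces\<close>

abbreviation "t_of \<equiv> fst"
abbreviation x_of :: "real \<times> 'a \<times> real \<Rightarrow> 'a" where "x_of p \<equiv> fst (snd p)"
abbreviation v_of :: "real \<times> 'a \<times> real \<Rightarrow> real" where "v_of p \<equiv> snd (snd p)"

lemma cw_metric_eq:
  "cw_metric S p u w = v_of u * t_of w + t_of u * v_of w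
     + (x_of p \<bullet> (S *v x_of p)) * (t_of u * t_of w) + x_of u \<bullet> x_of w"
  by (simp add: cw_metric_def split: prod.splits)

lemma cw_metric_bilinear: "bilinear (cw_metric S p)"
  unfolding bilinear_def cw_metric_eq by (auto intro!: linearI simp: algebra_simps)

lemma cw_metric_sym: "cw_metric S p u w = cw_metric S p w u"
  by (simp add: cw_metric_eq inner_commute algebra_simps)

lemma cw_metric_nondegenerate:
  assumes "\<And>w. cw_metric S p u w = 0"
  shows "u = 0"
proof -
  have "t_of u = 0" using assms[of "(0, 0, 1)"] by (simp add: cw_metric_eq)
  moreover have "x_of u = 0" using assms[of "(0, x_of u, 0)"] calculation
    by (simp add: cw_metric_eq)
  moreover have "v_of u = 0" using assms[of "(1, 0, 0)"] calculation by (simp add: cw_metric_eq)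
  ultimately show ?thesis by (simp add: prod_eq_iff)
qed

lemma Ck_on_norm_squared:
  assumes "open U" "bounded_linear l"
  shows "Ck_on k U (\<lambda>p. l p \<bullet> l p)"
proof (cases k)
  case 0
  thus ?thesis using linear_continuous_on[OF assms(2), of U] by (auto intro: continuous_intros)
next
  case (Suc j)
  have "bounded_linear (\<lambda>p. 2 * (l p \<bullet> l u))" for u
    by (intro bounded_linear_const_mult bounded_linear_inner_left_comp assms(2))
  hence *: "Ck_on j U (\<lambda>p. 2 * (l p \<bullet> l u))" for u by (rule Ck_on_bounded_linear[OF assms(1)])
  have "((\<lambda>p. l p \<bullet> l p) has_derivative (\<lambda>u. 2 * (l p \<bullet> l u))) (at p)" for p
    by (rule derivative_eq_intros bounded_linear_imp_has_derivative[OF assms(2)] refl)+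
       (simp add: inner_commute)
  thus ?thesis unfolding Suc by (intro Ck_on_SucI[OF assms(1) _ *])
qed

text \<open>The conformal factor depends on \<open>t\<close> only, and flatness reduces to a Riccati equation for
  its logarithmic derivative \<open>y\<close>.\<close>

locale riccati =
  fixes S :: "real^'n^'n" and \<mu> :: real and I :: "real set" and f y :: "real \<Rightarrow> real"
  assumes S: "x \<bullet> (S *v x) = \<mu> * (x \<bullet> x)" and I: "open I"
    and f: "t \<in> I \<Longrightarrow> (f has_field_derivative y t) (at t)"
    and y: "t \<in> I \<Longrightarrow> (y has_field_derivative (y t)\<^sup>2 - \<mu>) (at t)"
begin

abbreviation U :: "(real \<times> (real^'n) \<times> real) set" where "U \<equiv> {p. t_of p \<in> I}"
abbreviation h :: "(real \<times> (real^'n) \<times> real) metric" where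
  "h \<equiv> conformal_change (\<lambda>p. f (t_of p)) (cw_metric S)"

lemma open_U: "open U"
proof -
  have "U = I \<times> UNIV" by auto
  thus ?thesis using I open_Times by auto
qed

lemma f_fst: "p \<in> U \<Longrightarrow> ((\<lambda>p. f (t_of p)) has_derivative (\<lambda>u. y (t_of p) * t_of u)) (at p)"
  using has_derivative_compose[OF has_derivative_fst[OF has_derivative_ident] f[unfolded has_field_derivative_def]]
  by (cases p) auto

lemma y_fst: "p \<in> U \<Longrightarrow> ((\<lambda>p. y (t_of p)) has_derivative (\<lambda>u. ((y (t_of p))\<^sup>2 - \<mu>) * t_of u)) (at p)"
  using has_derivative_compose[OF has_derivative_fst[OF has_derivative_ident] y[unfolded has_field_derivative_def]]
  by (cases p) auto

text \<open>Bootstrapping: the Riccati equation makes the derivative of \<open>y\<close> a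
  polynomial in \<open>y\<close>, so each order of smoothness yields the next.\<close>

lemma Ck_y: "Ck_on k U (\<lambda>p. y (t_of p))"
proof (induction k)
  case 0
  have "continuous (at p) (\<lambda>p. y (t_of p))" if "p \<in> U" for p
    using has_derivative_continuous[OF y_fst[OF that]] .
  thus ?case unfolding Ck_on.simps by (intro continuous_at_imp_continuous_on ballI)
next
  case (Suc k)
  have "Ck_on k U (\<lambda>p. (y (t_of p) * y (t_of p) + (- \<mu>)) * t_of u)" for u
    by (intro Ck_on_mult Ck_on_add Ck_on_const Suc open_U)
  hence *: "Ck_on k U (\<lambda>p. ((y (t_of p))\<^sup>2 - \<mu>) * t_of u)" for u
    by (simp add: power2_eq_square)
  show ?case by (rule Ck_on_SucI[OF open_U y_fst *])
qed

lemma Ck_f: "Ck_on k U (\<lambda>p. f (t_of p))"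
proof (rule Ck_on_Suc_le)
  show "Ck_on (Suc k) U (\<lambda>p. f (t_of p))"
    by (rule Ck_on_SucI[OF open_U f_fst Ck_on_mult[OF open_U Ck_y Ck_on_const[OF open_U]]])
qed

lemma h_eq: "h p u w = exp (2 * f (t_of p)) * (v_of u * t_of w + t_of u * v_of w
     + \<mu> * (x_of p \<bullet> x_of p) * (t_of u * t_of w) + x_of u \<bullet> x_of w)"
  by (simp add: conformal_change_def cw_metric_eq S)

lemma Ck_h: "Ck_on k U (\<lambda>p. h p u w)"
proof -
  have "bounded_linear (\<lambda>p :: real \<times> (real^'n) \<times> real. x_of p)"
    by (intro bounded_linear_compose[OF bounded_linear_fst bounded_linear_snd])
  hence "Ck_on k U (\<lambda>p. exp (2 * f (t_of p)) * (((v_of u * t_of w + t_of u * v_of w)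
     + \<mu> * (x_of p \<bullet> x_of p) * (t_of u * t_of w)) + x_of u \<bullet> x_of w))"
    by (intro Ck_on_mult Ck_on_add Ck_on_const Ck_on_exp Ck_f open_U Ck_on_norm_squared)
  thus ?thesis by (simp add: h_eq)
qed

lemma h_nondegenerate: "(\<And>w. h p u w = 0) \<Longrightarrow> u = 0"
  using cw_metric_nondegenerate[of S p u] by (simp add: conformal_change_def)

lemma semi_riemannian_h: "semi_riemannian U h"
proof -
  have "bilinear (h p)" for p
    unfolding bilinear_def conformal_change_def
    by (intro conjI allI linearI) (simp_all add: bilinear_ladd[OF cw_metric_bilinear] bilinear_radd[OF cw_metric_bilinear]
        bilinear_lmul[OF cw_metric_bilinear] bilinear_rmul[OF cw_metric_bilinear] algebra_simps)
  moreover have "h p u w = h p w u" for p u w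
    by (simp add: conformal_change_def cw_metric_sym)
  ultimately show ?thesis
    unfolding semi_riemannian_def smooth_on_def
    by (intro conjI ballI allI impI open_U Ck_h h_nondegenerate) (assumption | erule spec)+
qed

lemma h_deriv:
  assumes "p \<in> U"
  shows "((\<lambda>q. h q u w) has_derivative (\<lambda>z. 2 * y (t_of p) * t_of z * h p u w
     + exp (2 * f (t_of p)) * (2 * \<mu> * (x_of p \<bullet> x_of z) * (t_of u * t_of w)))) (at p)"
  unfolding h_eq
  by (rule derivative_eq_intros f_fst assms refl)+ (simp add: inner_commute algebra_simps)

text \<open>This is the conformal formula \<open>\<Gamma> + df u w + df w u - g u w G\<close> with
  \<open>S\<close> replaced by \<open>\<mu>\<close> times the identity, df = y dt and gradient y
  d/dv.\<close>

definition K :: "real \<times> (real^'n) \<times> real \<Rightarrow> real \<times> (real^'n) \<times> real \<Rightarrow> real \<times> (real^'n) \<times> real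
    \<Rightarrow> real \<times> (real^'n) \<times> real" where
  "K p u w = (2 * y (t_of p) * t_of u * t_of w,
    (- \<mu> * t_of u * t_of w) *\<^sub>R x_of p + y (t_of p) *\<^sub>R (t_of u *\<^sub>R x_of w + t_of w *\<^sub>R x_of u),
    \<mu> * (x_of u \<bullet> x_of p * t_of w + x_of w \<bullet> x_of p * t_of u)
     - y (t_of p) * \<mu> * (x_of p \<bullet> x_of p) * t_of u * t_of w
     - y (t_of p) * (x_of u \<bullet> x_of w))"

lemma christoffel_h:
  assumes p: "p \<in> U"
  shows "christoffel h p u w = K p u w"
proof -
  note fr = frechet_derivative_at[OF h_deriv[OF p], symmetric]
  have K: "2 * h p (K p u w) z = frechet_derivative (\<lambda>q. h q w z) (at p) u
     + frechet_derivative (\<lambda>q. h q u z) (at p) w - frechet_derivative (\<lambda>q. h q u w) (at p) z" for z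
    unfolding fr unfolding h_eq K_def
    by (simp add: inner_commute inner_add_left inner_add_right algebra_simps)
  show ?thesis unfolding christoffel_def
  proof (rule the_equality)
    fix k
    assume "\<forall>z. 2 * h p k z = frechet_derivative (\<lambda>q. h q w z) (at p) u
     + frechet_derivative (\<lambda>q. h q u z) (at p) w - frechet_derivative (\<lambda>q. h q u w) (at p) z"
    hence "h p k z = h p (K p u w) z" for z using K[of z] by (metis mult_cancel_left zero_neq_numeral)
    hence "cw_metric S p (k - K p u w) z = 0" for z
      by (simp add: conformal_change_def bilinear_lsub[OF cw_metric_bilinear])
    thus "k = K p u w" using cw_metric_nondegenerate[of S p "k - K p u w"] by simp
  qed (use K in blast)
qed

text \<open>The derivative of \<open>K\<close> in direction \<open>z\<close>; \<open>y'\<close> is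
  the derivative of \<open>y\<close> along \<open>z\<close> with the Riccati equation already
  inserted.\<close>

definition dK :: "real \<times> (real^'n) \<times> real \<Rightarrow> real \<times> (real^'n) \<times> real \<Rightarrow> real \<times> (real^'n) \<times> real
    \<Rightarrow> real \<times> (real^'n) \<times> real \<Rightarrow> real \<times> (real^'n) \<times> real" where
  "dK p z u w = (let y' = ((y (t_of p))\<^sup>2 - \<mu>) * t_of z in
   (2 * y' * t_of u * t_of w,
    (- \<mu> * t_of u * t_of w) *\<^sub>R x_of z + y' *\<^sub>R (t_of u *\<^sub>R x_of w + t_of w *\<^sub>R x_of u),
    \<mu> * (x_of u \<bullet> x_of z * t_of w + x_of w \<bullet> x_of z * t_of u)
     - (y' * \<mu> * (x_of p \<bullet> x_of p) * t_of u * t_of w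
        + y (t_of p) * \<mu> * (2 * (x_of p \<bullet> x_of z)) * t_of u * t_of w)
     - y' * (x_of u \<bullet> x_of w)))"

lemma K_deriv: "p \<in> U \<Longrightarrow> ((\<lambda>q. K q u w) has_derivative (\<lambda>z. dK p z u w)) (at p)"
  unfolding K_def dK_def Let_def
  by (rule derivative_eq_intros y_fst refl | assumption)+
     (simp add: inner_commute algebra_simps)

text \<open>The origin of the Riccati equation: the part of R(d/dx_i, d/dt) d/dt along d/dx_i is y^2
  - \<mu> minus the derivative of y.\<close>

lemma flat_h: "flat_metric U h"
proof -
  have "riemann_curvature h p u w z = 0" if p: "p \<in> U" for p u w z
  proof -
    have fr: "frechet_derivative (\<lambda>q. christoffel h q u w) (at p) z = dK p z u w" for u w z
    proof -
      have "((\<lambda>q. christoffel h q u w) has_derivative (\<lambda>z. dK p z u w)) (at p)"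
        by (rule has_derivative_transform_within_open[OF K_deriv[OF p] open_U p])
           (rule christoffel_h[symmetric])
      from fun_cong[OF frechet_derivative_at[OF this]] show ?thesis by (rule sym)
    qed
    show ?thesis
      unfolding riemann_curvature_def fr christoffel_h[OF p] K_def dK_def Let_def
      apply (simp only: prod_eq_iff fst_add snd_add fst_diff snd_diff fst_conv snd_conv fst_zero snd_zero)
      apply (intro conjI)
        apply (simp add: algebra_simps)
       apply (rule euclidean_eqI)
       apply (simp only: inner_add_left inner_diff_left inner_scaleR_left inner_zero_left)
       apply (simp add: algebra_simps power2_eq_square)
      apply (simp add: inner_add_left inner_diff_left inner_add_right inner_commute algebra_simps power2_eq_square)
      done
  qed
  thus ?thesis unfolding flat_metric_def using semi_riemannian_h by blast
qed

lemma conformal_diffeo_h: "conformal_diffeo U (cw_metric S) U h (\<lambda>p. p)"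
proof -
  have id: "Ck_on k U (\<lambda>p. p)" for k by (rule Ck_on_bounded_linear[OF open_U bounded_linear_ident])
  \<comment> \<open>Outside \<open>U\<close> the value of \<open>inv_into\<close> is unspecified, so
    its smoothness is transferred from the identity through agreement on \<open>U\<close>.\<close>
  have "inv_into U (\<lambda>p. p) p = p" if "p \<in> U" for p
    using inv_into_f_f[of "\<lambda>p. p" U p] that by simp
  hence "Ck_on k U (inv_into U (\<lambda>p. p))" for k
    by (intro Ck_on_cong[OF open_U _ id]) auto
  hence "diffeo U U (\<lambda>p. p)"
    unfolding diffeo_def smooth_on_def using open_U id by (auto simp: bij_betw_def)
  moreover have "pullback (\<lambda>p. p) h p = h p" for p
    by (intro ext) (simp add: pullback_def)
  ultimately show ?thesis unfolding conformal_diffeo_def smooth_on_def using Ck_f by blast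
qed

end

lemma cw_conformally_flat:
  fixes S :: "real^'n^'n"
  assumes S: "\<And>x. x \<bullet> (S *v x) = \<mu> * (x \<bullet> x)"
  shows "conformally_flat UNIV (cw_metric S)"
  unfolding conformally_flat_def
proof
  fix p :: "real \<times> (real^'n) \<times> real"
  have "\<exists>I f y. t_of p \<in> I \<and> riccati S \<mu> I f y"
  proof (cases "\<mu> \<ge> 0")
    case True
    \<comment> \<open>A constant \<open>y\<close> solves the Riccati equation exactly when its
      square is \<open>\<mu>\<close>.\<close>
    hence "riccati S \<mu> UNIV (\<lambda>t. - sqrt \<mu> * t) (\<lambda>t. - sqrt \<mu>)"
      by unfold_locales (use S in \<open>auto intro!: derivative_eq_intros\<close>)
    thus ?thesis by (intro exI conjI) auto
  next
    case False
    \<comment> \<open>Now the equation reads y' = y^2 + c^2 and has no constant solution. The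
      solution c tan(c (t - t0)) is centred at the given point, where the cosine is 1, so the point
      lies in its domain; its primitive is -ln cos(c (t - t0)).\<close>
    define c where "c = sqrt (- \<mu>)"
    have c: "c\<^sup>2 = - \<mu>" using False by (simp add: c_def)
    define t0 where "t0 = t_of p"
    have "open {t. 0 < cos (c * (t - t0))}" by (intro open_Collect_less continuous_intros)
    moreover have "((\<lambda>t. - ln (cos (c * (t - t0)))) has_field_derivative c * tan (c * (t - t0))) (at t)"
      if "t \<in> {t. 0 < cos (c * (t - t0))}" for t
      using that by (auto intro!: derivative_eq_intros simp: tan_def)
    moreover have "((\<lambda>t. c * tan (c * (t - t0))) has_field_derivative (c * tan (c * (t - t0)))\<^sup>2 - \<mu>) (at t)"
      if "t \<in> {t. 0 < cos (c * (t - t0))}" for t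
    proof -
      have n: "cos (c * (t - t0)) \<noteq> 0" using that by auto
      have "((\<lambda>t. c * tan (c * (t - t0))) has_field_derivative c\<^sup>2 * (inverse (cos (c * (t - t0))))\<^sup>2) (at t)"
        using n by (auto intro!: derivative_eq_intros simp: power2_eq_square)
      moreover have "c\<^sup>2 * (inverse (cos (c * (t - t0))))\<^sup>2 = (c * tan (c * (t - t0)))\<^sup>2 - \<mu>"
        unfolding tan_sec[OF n, symmetric] using c by (simp add: power_mult_distrib algebra_simps)
      ultimately show ?thesis by simp
    qed
    ultimately have "riccati S \<mu> {t. 0 < cos (c * (t - t0))} (\<lambda>t. - ln (cos (c * (t - t0))))
        (\<lambda>t. c * tan (c * (t - t0)))"
      using S by unfold_locales
    moreover have "t_of p \<in> {t. 0 < cos (c * (t - t0))}" by (simp add: t0_def)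
    ultimately show ?thesis by (intro exI conjI)
  qed
  then obtain I f y where pI: "t_of p \<in> I" and "riccati S \<mu> I f y" by blast
  then interpret riccati S \<mu> I f y by simp
  let ?U = "U :: (real \<times> (real^'n) \<times> real) set"
  show "\<exists>U V h (\<psi> :: real \<times> (real^'n) \<times> real \<Rightarrow> real \<times> (real^'n) \<times> real). p \<in> U \<and> U \<subseteq> UNIV \<and>
      flat_metric V h \<and> conformal_diffeo U (cw_metric S) V h \<psi>"
    by (rule exI[of _ ?U], rule exI[of _ ?U], rule exI[of _ h], rule exI[of _ "\<lambda>p :: real \<times> (real^'n) \<times> real. p"])
       (use pI flat_h conformal_diffeo_h in simp)
qed

section \<open>Conformal transformations of Cahen-Wallach spaces\<close>

lemma symmetric_matrix_inner:
  fixes S :: "real^'n^'n"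
  assumes "transpose S = S"
  shows "x \<bullet> (S *v y) = (S *v x) \<bullet> y"
  by (metis assms dot_lmul_matrix transpose_matrix_vector)

definition cw_\<Gamma> :: "real^'n^'n \<Rightarrow> real \<times> (real^'n) \<times> real \<Rightarrow> real \<times> (real^'n) \<times> real
    \<Rightarrow> real \<times> (real^'n) \<times> real \<Rightarrow> real \<times> (real^'n) \<times> real" where
  "cw_\<Gamma> S p u w = (0, - (t_of u * t_of w) *\<^sub>R (S *v x_of p),
     (x_of u \<bullet> (S *v x_of p)) * t_of w + (x_of w \<bullet> (S *v x_of p)) * t_of u)"

lemma has_derivative_matrix_vector [derivative_intros]:
  fixes S :: "real^'n^'m"
  shows "(f has_derivative f') F \<Longrightarrow> ((\<lambda>p. S *v f p) has_derivative (\<lambda>u. S *v f' u)) F"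
  by (rule bounded_linear.has_derivative[OF matrix_vector_mul_bounded_linear])

lemma smooth_onD2:
  assumes "smooth_on UNIV F"
  shows "(F has_derivative frechet_derivative F (at p)) (at p)"
    and "((\<lambda>q. frechet_derivative F (at q) u) has_derivative
           frechet_derivative (\<lambda>q. frechet_derivative F (at q) u) (at p)) (at p)"
proof -
  have F: "Ck_on (Suc (Suc 0)) UNIV F" using assms unfolding smooth_on_def by blast
  show "(F has_derivative frechet_derivative F (at p)) (at p)" by (rule Ck_on_SucD[OF F UNIV_I])
  have "Ck_on (Suc 0) UNIV (\<lambda>q. frechet_derivative F (at q) u)"
    using F unfolding Ck_on.simps(2)[of "Suc 0"] by blast
  thus "((\<lambda>q. frechet_derivative F (at q) u) has_derivative
           frechet_derivative (\<lambda>q. frechet_derivative F (at q) u) (at p)) (at p)"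
    by (rule Ck_on_SucD[OF _ UNIV_I])
qed

lemma smooth_on_derivative:
  assumes "smooth_on UNIV F"
  shows "smooth_on UNIV (\<lambda>q. frechet_derivative F (at q) u)"
  unfolding smooth_on_def
proof
  fix k
  have "Ck_on (Suc k) UNIV F" using assms unfolding smooth_on_def by blast
  thus "Ck_on k UNIV (\<lambda>q. frechet_derivative F (at q) u)" by simp
qed

lemma smooth_on_second_derivative_symmetric:
  fixes F :: "'a::euclidean_space \<Rightarrow> 'b::euclidean_space"
  assumes "smooth_on UNIV F"
  shows "frechet_derivative (\<lambda>q. frechet_derivative F (at q) u) (at p) w
    = frechet_derivative (\<lambda>q. frechet_derivative F (at q) w) (at p) u"
proof -
  have "Ck_on 0 UNIV (\<lambda>q. frechet_derivative (\<lambda>q. frechet_derivative F (at q) u) (at q) z)" for z u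
    using smooth_on_derivative[OF smooth_on_derivative[OF assms]] unfolding smooth_on_def by blast
  hence cont: "continuous_on UNIV (\<lambda>q. frechet_derivative (\<lambda>q. frechet_derivative F (at q) u) (at q) z)"
    for z u by simp
  show ?thesis
    by (rule second_derivative_symmetric[OF smooth_onD2[OF assms] cont])
qed

text \<open>Comparing the extrema of the quadratic form on spheres shows that the scale \<open>\<alpha>\<close> preserves the
  positive spread between them.\<close>

lemma quadratic_form_spread:
  fixes S :: "real^'n^'n" and B :: "real^'n \<Rightarrow> real^'n"
  assumes not_scalar: "\<not> (\<exists>\<mu>. \<forall>x. x \<bullet> (S *v x) = \<mu> * (x \<bullet> x))"
    and e: "e > 0" and B: "linear B" "\<And>x. B x \<bullet> B x = e * (x \<bullet> x)"
    and \<alpha>: "\<alpha> \<ge> 0" and eq: "\<And>x. \<alpha> * (B x \<bullet> (S *v B x)) = e * (x \<bullet> (S *v x) - k * (x \<bullet> x))"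
  shows "\<alpha> = 1"
proof -
  define Q where "Q x = x \<bullet> (S *v x)" for x
  have sphere: "compact (sphere (0 :: real^'n) 1)" "sphere (0 :: real^'n) 1 \<noteq> {}"
    by (auto simp: compact_sphere)
  have cont: "continuous_on (sphere 0 1) Q"
    unfolding Q_def by (intro continuous_intros linear_continuous_on matrix_vector_mul_bounded_linear)
  obtain y1 where y1: "norm y1 = 1" "\<And>x. norm x = 1 \<Longrightarrow> Q x \<le> Q y1"
    using continuous_attains_sup[OF sphere cont] by auto
  obtain y0 where y0: "norm y0 = 1" "\<And>x. norm x = 1 \<Longrightarrow> Q y0 \<le> Q x"
    using continuous_attains_inf[OF sphere cont] by auto
  have y11: "y1 \<bullet> y1 = 1" "y0 \<bullet> y0 = 1" using y1(1) y0(1) by (simp_all add: norm_eq_1)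
  have scale: "Q (c *\<^sub>R x) = c\<^sup>2 * Q x" for c x
    unfolding Q_def by (simp add: matrix_vector_mult_scaleR power2_eq_square)
  have bounds: "Q y0 * (x \<bullet> x) \<le> Q x \<and> Q x \<le> Q y1 * (x \<bullet> x)" for x
  proof (cases "x = 0")
    case True
    thus ?thesis by (simp add: Q_def)
  next
    case False
    define u where "u = (1 / norm x) *\<^sub>R x"
    have u: "norm u = 1" "x = norm x *\<^sub>R u" using False by (simp_all add: u_def)
    have "Q x = (x \<bullet> x) * Q u" using scale[of "norm x" u] u(2) by (simp add: power2_norm_eq_inner)
    moreover have "x \<bullet> x \<ge> 0" by simp
    ultimately show ?thesis using y1(2)[OF u(1)] y0(2)[OF u(1)]
      by (metis mult.commute mult_left_mono)
  qed
  have lt: "Q y0 < Q y1"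
  proof (rule ccontr)
    assume "\<not> Q y0 < Q y1"
    hence "Q x = Q y1 * (x \<bullet> x)" for x
      using bounds[of x] y1(2)[OF y0(1)] by auto
    thus False using not_scalar unfolding Q_def by blast
  qed
  have eq': "\<alpha> * Q (B x) = e * (Q x - k * (x \<bullet> x))" for x using eq unfolding Q_def .
  have "surj B"
  proof (rule linear_inj_imp_surj[OF B(1)], subst linear_injective_0[OF B(1)], safe)
    fix x assume "B x = 0"
    hence "e * (x \<bullet> x) = 0" using B(2)[of x] by simp
    thus "x = 0" using e by simp
  qed
  \<comment> \<open>Preimages of the extremal vectors bound \<open>\<alpha>\<close> above by 1;
    their images \<open>B y1\<close> and \<open>B y0\<close>, used further down, bound it below. In
    both cases the unknown \<open>k\<close> drops out when the two inequalities are
    subtracted.\<close>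
  then obtain x1 x0 where x: "B x1 = y1" "B x0 = y0" by (metis surjD)
  have xn: "e * (x1 \<bullet> x1) = 1" "e * (x0 \<bullet> x0) = 1" using B(2)[of x1] B(2)[of x0] x y11 by simp_all
  have "\<alpha> * Q y1 \<le> Q y1 - k"
  proof -
    have "\<alpha> * Q y1 = e * Q x1 - k * (e * (x1 \<bullet> x1))" using eq'[of x1] x by (simp add: algebra_simps)
    also have "e * Q x1 \<le> e * (Q y1 * (x1 \<bullet> x1))" using bounds[of x1] e by simp
    also have "\<dots> = Q y1 * (e * (x1 \<bullet> x1))" by simp
    finally show ?thesis by (simp add: xn)
  qed
  moreover have "\<alpha> * Q y0 \<ge> Q y0 - k"
  proof -
    have "Q y0 = Q y0 * (e * (x0 \<bullet> x0))" by (simp add: xn)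
    also have "\<dots> = e * (Q y0 * (x0 \<bullet> x0))" by simp
    also have "\<dots> \<le> e * Q x0" using bounds[of x0] e by simp
    also have "\<dots> = \<alpha> * Q y0 + k * (e * (x0 \<bullet> x0))" using eq'[of x0] x by (simp add: algebra_simps)
    finally show ?thesis by (simp add: xn)
  qed
  ultimately have "\<alpha> * (Q y1 - Q y0) \<le> 1 * (Q y1 - Q y0)" by (simp add: algebra_simps)
  hence le: "\<alpha> \<le> 1" using lt by (simp add: mult_le_cancel_right)
  have "e * (Q y1 - k) \<le> e * (\<alpha> * Q y1)"
  proof -
    have "e * (Q y1 - k) = \<alpha> * Q (B y1)" using eq'[of y1] y11 by simp
    also have "\<dots> \<le> \<alpha> * (Q y1 * e)" using bounds[of "B y1"] B(2)[of y1] y11 \<alpha> by (simp add: mult_left_mono)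
    finally show ?thesis by (simp add: mult_ac)
  qed
  moreover have "e * (\<alpha> * Q y0) \<le> e * (Q y0 - k)"
  proof -
    have "\<alpha> * (Q y0 * e) \<le> \<alpha> * Q (B y0)" using bounds[of "B y0"] B(2)[of y0] y11 \<alpha> by (simp add: mult_left_mono)
    also have "\<dots> = e * (Q y0 - k)" using eq'[of y0] y11 by simp
    finally show ?thesis by (simp add: mult_ac)
  qed
  ultimately have "Q y1 - k \<le> \<alpha> * Q y1" "\<alpha> * Q y0 \<le> Q y0 - k" using e by simp_all
  hence "1 * (Q y1 - Q y0) \<le> \<alpha> * (Q y1 - Q y0)" by (simp add: algebra_simps)
  hence "1 \<le> \<alpha>" using lt by (simp add: mult_le_cancel_right)
  with le show ?thesis by simp
qed

section \<open>The derivatives of a conformal transformation\<close>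

locale cw_conformal =
  fixes S :: "real^'n^'n" and \<phi> :: "real \<times> (real^'n) \<times> real \<Rightarrow> real \<times> (real^'n) \<times> real"
    and f :: "real \<times> (real^'n) \<times> real \<Rightarrow> real"
  assumes S_sym: "x \<bullet> (S *v y) = (S *v x) \<bullet> y"
    and smooth_\<phi>: "smooth_on UNIV \<phi>" and smooth_f: "smooth_on UNIV f"
    and conf: "pullback \<phi> (cw_metric S) p = conformal_change f (cw_metric S) p"
begin

abbreviation "g \<equiv> cw_metric S"
abbreviation "\<Gamma> \<equiv> cw_\<Gamma> S"

definition "L p u = frechet_derivative \<phi> (at p) u"
definition "H p z u = frechet_derivative (\<lambda>q. L q u) (at p) z"
definition "T p y z u = frechet_derivative (\<lambda>q. H q z u) (at p) y"
definition "df p u = frechet_derivative f (at p) u"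
definition "ddf p z u = frechet_derivative (\<lambda>q. df q u) (at p) z"
definition dg :: "real \<times> (real^'n) \<times> real \<Rightarrow> (real \<times> (real^'n) \<times> real) metric" where
  "dg p z u w = 2 * (x_of z \<bullet> (S *v x_of p)) * (t_of u * t_of w)"
text \<open>The inverse metric exchanges d/dt and d/dv, with a correction by the quadratic form in
  the d/dv component.\<close>

definition "G p = (df p (0, 0, 1), \<Sum>b\<in>Basis. df p (0, b, 0) *\<^sub>R b,
  df p (1, 0, 0) - (x_of p \<bullet> (S *v x_of p)) * df p (0, 0, 1))"
definition "dG p z = (ddf p z (0, 0, 1), \<Sum>b\<in>Basis. ddf p z (0, b, 0) *\<^sub>R b,
  ddf p z (1, 0, 0) - ((x_of p \<bullet> (S *v x_of p)) * ddf p z (0, 0, 1)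
     + (x_of p \<bullet> (S *v x_of z) + x_of z \<bullet> (S *v x_of p)) * df p (0, 0, 1)))"

lemma S_swap: "x \<bullet> (S *v y) = y \<bullet> (S *v x)"
  using S_sym inner_commute by metis

lemma smooth_L: "smooth_on UNIV (\<lambda>q. L q u)"
  unfolding L_def by (rule smooth_on_derivative[OF smooth_\<phi>])
lemma smooth_H: "smooth_on UNIV (\<lambda>q. H q z u)"
  unfolding H_def by (rule smooth_on_derivative[OF smooth_L])
lemma smooth_df: "smooth_on UNIV (\<lambda>q. df q u)"
  unfolding df_def by (rule smooth_on_derivative[OF smooth_f])

lemma df_deriv0: "(f has_derivative df p) (at p)"
  using smooth_onD2(1)[OF smooth_f] unfolding df_def .
lemma df_deriv1: "((\<lambda>q. df q u) has_derivative (\<lambda>z. ddf p z u)) (at p)"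
  using smooth_onD2(1)[OF smooth_df] unfolding ddf_def .

lemma df_linear: "linear (df p)" using df_deriv0 has_derivative_linear by blast

lemma G_gradient: "g p (G p) z = df p z"
proof -
  note l = linear_add[OF df_linear] linear_cmul[OF df_linear] linear_sum[OF df_linear]
  have e: "(0, x, 0) = (\<Sum>b\<in>Basis. (x \<bullet> b) *\<^sub>R (0::real, b, 0::real))" for x :: "real^'n"
    by (simp add: prod_eq_iff fst_sum snd_sum euclidean_representation)
  have "z = t_of z *\<^sub>R (1, 0, 0) + (0, x_of z, 0) + v_of z *\<^sub>R (0, 0, 1)" by (simp add: prod_eq_iff)
  hence "df p z = df p (t_of z *\<^sub>R (1, 0, 0) + (0, x_of z, 0) + v_of z *\<^sub>R (0, 0, 1))" by simp
  also have "\<dots> = t_of z * df p (1, 0, 0) + (\<Sum>b\<in>Basis. (x_of z \<bullet> b) * df p (0, b, 0)) + v_of z * df p (0, 0, 1)"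
    unfolding l e[of "x_of z"] by simp
  finally show ?thesis
    by (simp add: cw_metric_eq G_def inner_sum_left inner_sum_right inner_commute algebra_simps)
qed

text \<open>\<open>cw_\<Gamma>\<close> is linear in the base point. Its derivative in direction
  \<open>z\<close> is therefore \<open>\<Gamma> z\<close> at every point, which explains the
  argument \<open>\<lambda>p. \<Gamma>\<close>.\<close>

sublocale conformal_jet g dg \<Gamma> "\<lambda>p. \<Gamma>" \<phi> L H T f df ddf G dG
proof
  fix p u w z y :: "real \<times> (real^'n) \<times> real"
  show "bilinear (g p)" by (rule cw_metric_bilinear)
  show "g p u w = g p w u" by (rule cw_metric_sym)
  show "u = 0" if "\<And>w. g p u w = 0" by (rule cw_metric_nondegenerate) (rule that)
  show "((\<lambda>q. g q u w) has_derivative (\<lambda>z. dg p z u w)) (at p)"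
  proof -
    have "x_of p \<bullet> (S *v x_of z) = x_of z \<bullet> (S *v x_of p)" for z :: "real \<times> (real^'n) \<times> real"
      by (rule S_swap)
    hence *: "dg p z u w = (x_of p \<bullet> (S *v x_of z) + x_of z \<bullet> (S *v x_of p)) * (t_of u * t_of w)" for z
      unfolding dg_def by simp
    show ?thesis unfolding cw_metric_eq *
      by (rule derivative_eq_intros refl)+ (simp add: algebra_simps)
  qed
  show "bilinear (\<Gamma> p)"
    unfolding bilinear_def cw_\<Gamma>_def
    by (intro conjI allI linearI) (simp_all add: prod_eq_iff inner_add_left algebra_simps)
  show "\<Gamma> p u w = \<Gamma> p w u" unfolding cw_\<Gamma>_def by (simp add: algebra_simps)
  show "((\<lambda>q. \<Gamma> q u w) has_derivative (\<lambda>z. \<Gamma> z u w)) (at p)"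
    unfolding cw_\<Gamma>_def by (rule derivative_eq_intros refl)+ (simp add: algebra_simps)
  show "2 * g p (\<Gamma> p u w) z = dg p u w z + dg p w u z - dg p z u w"
    unfolding cw_metric_eq cw_\<Gamma>_def dg_def by (simp add: inner_commute algebra_simps)
  show "(\<phi> has_derivative L p) (at p)"
    using smooth_onD2(1)[OF smooth_\<phi>] unfolding L_def .
  show "((\<lambda>q. L q u) has_derivative (\<lambda>z. H p z u)) (at p)"
    using smooth_onD2(1)[OF smooth_L] unfolding H_def .
  show "((\<lambda>q. H q z u) has_derivative (\<lambda>y. T p y z u)) (at p)"
    using smooth_onD2(1)[OF smooth_H] unfolding T_def .
  show "H p z u = H p u z"
    unfolding H_def L_def by (rule smooth_on_second_derivative_symmetric[OF smooth_\<phi>])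
  show "T p y z u = T p z y u"
    unfolding T_def H_def by (rule smooth_on_second_derivative_symmetric[OF smooth_L])
  show "(f has_derivative df p) (at p)" by (rule df_deriv0)
  show "((\<lambda>q. df q u) has_derivative (\<lambda>z. ddf p z u)) (at p)" by (rule df_deriv1)
  show "g p (G p) z = df p z" by (rule G_gradient)
  show "(G has_derivative dG p) (at p)"
    unfolding G_def dG_def
    by (rule derivative_eq_intros df_deriv1 refl)+
  show "g (\<phi> p) (L p u) (L p w) = exp (2 * f p) * g p u w"
    using fun_cong[OF fun_cong[OF conf[of p]]] unfolding pullback_def conformal_change_def L_def by blast
qed

lemma linear_spatial_part: "linear (\<lambda>x. x_of (L p (0, x, 0)))"
proof (rule linearI)
  fix x y :: "real^'n" and c :: real
  have "L p (0, x + y, 0) = L p (0, x, 0) + L p (0, y, 0)" by (simp add: L_lin[symmetric])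
  thus "x_of (L p (0, x + y, 0)) = x_of (L p (0, x, 0)) + x_of (L p (0, y, 0))" by simp
  have "L p (0, c *\<^sub>R x, 0) = c *\<^sub>R L p (0, x, 0)" by (simp add: L_lin[symmetric])
  thus "x_of (L p (0, c *\<^sub>R x, 0)) = c *\<^sub>R x_of (L p (0, x, 0))" by simp
qed

lemma sectional_cw: "g p (curv p b a a) b = - ((t_of a *\<^sub>R x_of b - t_of b *\<^sub>R x_of a) \<bullet>
    (S *v (t_of a *\<^sub>R x_of b - t_of b *\<^sub>R x_of a)))"
  unfolding curv_def cw_metric_eq cw_\<Gamma>_def using S_swap[of "x_of a" "x_of b"]
  by (simp add: matrix_vector_mult_diff_distrib matrix_vector_mult_scaleR inner_diff_left
      inner_diff_right inner_add_left inner_add_right inner_commute algebra_simps)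

end

section \<open>The differential when \<open>S\<close> is not a multiple of the identity\<close>

locale cw_conformal_nonflat = cw_conformal S \<phi> f for S :: "real^'n^'n" and \<phi> f +
  assumes not_scalar: "\<not> (\<exists>\<mu>. \<forall>x. x \<bullet> (S *v x) = \<mu> * (x \<bullet> x))"
begin

text \<open>Curvature vanishes on every plane through d/dv. If the image of d/dv had a t-component
  \<open>t'\<close>, the image planes would carry the value of \<open>S\<close> at \<open>t'\<close>
  times an arbitrary \<open>x\<close>, and \<open>sectional_relation\<close> would make
  \<open>S\<close> scalar.\<close>

lemma L_v: "t_of (L p (0, 0, 1)) = 0" "x_of (L p (0, 0, 1)) = 0"
proof -
  let ?a = "(0, 0, 1) :: real \<times> (real^'n) \<times> real"
  have aa: "g p ?a ?a = 0" by (simp add: cw_metric_eq)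
  define k where "k = df p (\<Gamma> p ?a ?a) + (df p ?a)\<^sup>2 - ddf p ?a ?a"
  show t: "t_of (L p ?a) = 0"
  proof (rule ccontr)
    define t' where "t' = t_of (L p ?a)"
    assume "t_of (L p ?a) \<noteq> 0"
    hence t': "t' \<noteq> 0" by (simp add: t'_def)
    have "x \<bullet> (S *v x) = - k / t'\<^sup>2 * (x \<bullet> x)" for x
    proof -
      \<comment> \<open>The last coordinate is chosen so that \<open>L p b\<close> is orthogonal to
        \<open>L p ?a\<close>.\<close>
      obtain b where b: "L p b = (0, x, - (x_of (L p ?a) \<bullet> x) / t')" using surj_L surjD by metis
      have "g (\<phi> p) (L p ?a) (L p b) = 0"
        unfolding b using t' by (simp add: cw_metric_eq t'_def)
      hence ab: "g p ?a b = 0" unfolding conformal by simp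
      have "- ((t' *\<^sub>R x) \<bullet> (S *v (t' *\<^sub>R x))) = exp (2 * f p) * (k * g p b b)"
        using sectional_relation[OF aa ab] unfolding sectional_cw b k_def by (simp add: t'_def)
      also have "\<dots> = k * g (\<phi> p) (L p b) (L p b)" unfolding conformal by simp
      also have "\<dots> = k * (x \<bullet> x)" unfolding b by (simp add: cw_metric_eq)
      finally have "- t'\<^sup>2 * (x \<bullet> (S *v x)) = k * (x \<bullet> x)"
        by (simp add: matrix_vector_mult_scaleR power2_eq_square)
      thus ?thesis using t' by (simp add: field_simps)
    qed
    thus False using not_scalar by blast
  qed
  have "g (\<phi> p) (L p ?a) (L p ?a) = 0" unfolding conformal using aa by simp
  thus "x_of (L p ?a) = 0" using t by (simp add: cw_metric_eq)
qed

definition "\<alpha> p = t_of (L p (1, 0, 0))"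

text \<open>Pairing with d/dv reads off the t-component, on the source and, by \<open>L_v\<close>,
  also on the target.\<close>

lemma L_t: "t_of (L p w) = \<alpha> p * t_of w" and \<alpha>_L_v: "\<alpha> p * v_of (L p (0, 0, 1)) = exp (2 * f p)"
proof -
  have *: "v_of (L p (0, 0, 1)) * t_of (L p w) = exp (2 * f p) * t_of w" for w
    using conformal[of p "(0, 0, 1)" w] by (simp add: cw_metric_eq L_v)
  show \<alpha>: "\<alpha> p * v_of (L p (0, 0, 1)) = exp (2 * f p)"
    using *[of "(1, 0, 0)"] by (simp add: \<alpha>_def mult.commute)
  hence "v_of (L p (0, 0, 1)) \<noteq> 0" by auto
  moreover have "v_of (L p (0, 0, 1)) * t_of (L p w) = v_of (L p (0, 0, 1)) * (\<alpha> p * t_of w)"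
    unfolding * \<alpha>[symmetric] by simp
  ultimately show "t_of (L p w) = \<alpha> p * t_of w" by simp
qed

lemma \<alpha>_squared: "(\<alpha> p)\<^sup>2 = 1"
proof -
  \<comment> \<open>The null lift of d/dt that is orthogonal to all spatial vectors; the last
    coordinate cancels the quadratic form in the metric.\<close>
  let ?a = "(1, 0, - (x_of p \<bullet> (S *v x_of p)) / 2) :: real \<times> (real^'n) \<times> real"
  have aa: "g p ?a ?a = 0" by (simp add: cw_metric_eq)
  define k where "k = df p (\<Gamma> p ?a ?a) + (df p ?a)\<^sup>2 - ddf p ?a ?a"
  define B where "B x = x_of (L p (0, x, 0))" for x
  have linB: "linear B" unfolding B_def by (rule linear_spatial_part)
  have "B x \<bullet> B x = exp (2 * f p) * (x \<bullet> x)" for x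
    using conformal[of p "(0, x, 0)" "(0, x, 0)"] by (simp add: cw_metric_eq L_t B_def)
  moreover have "(\<alpha> p)\<^sup>2 * (B x \<bullet> (S *v B x)) = exp (2 * f p) * (x \<bullet> (S *v x) - k * (x \<bullet> x))" for x
  proof -
    let ?b = "(0, x, 0) :: real \<times> (real^'n) \<times> real"
    have ab: "g p ?a ?b = 0" by (simp add: cw_metric_eq)
    have "- ((\<alpha> p *\<^sub>R B x) \<bullet> (S *v (\<alpha> p *\<^sub>R B x))) = exp (2 * f p) * (- (x \<bullet> (S *v x)) + k * (x \<bullet> x))"
      using sectional_relation[OF aa ab] unfolding sectional_cw k_def[symmetric]
      by (simp add: L_t B_def cw_metric_eq)
    thus ?thesis by (simp add: matrix_vector_mult_scaleR power2_eq_square algebra_simps)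
  qed
  ultimately show ?thesis
    by (intro quadratic_form_spread[OF not_scalar exp_gt_zero linB]) auto
qed

lemma L_component_deriv:
  assumes "bounded_linear l"
  shows "((\<lambda>q. l (L q u)) has_derivative (\<lambda>z. l (H p z u))) (at p)"
  by (rule bounded_linear.has_derivative[OF assms L_deriv])

lemma bounded_linear_components:
  "bounded_linear t_of" "bounded_linear x_of" "bounded_linear v_of"
  by (intro bounded_linear_fst bounded_linear_compose[OF bounded_linear_fst bounded_linear_snd]
      bounded_linear_compose[OF bounded_linear_snd bounded_linear_snd])+

text \<open>The square of \<open>\<alpha>\<close> is constant and \<open>\<alpha>\<close> never
  vanishes, so 2 \<alpha> d\<alpha> = 0 gives d\<alpha> = 0.\<close>

lemma \<alpha>_constant: "\<alpha> p = \<alpha> q"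
proof -
  have d: "(\<alpha> has_derivative (\<lambda>z. t_of (H p z (1, 0, 0)))) (at p)" for p
    unfolding \<alpha>_def by (rule L_component_deriv[OF bounded_linear_fst])
  have "((\<lambda>p. (\<alpha> p)\<^sup>2) has_derivative (\<lambda>z. 2 * \<alpha> p * t_of (H p z (1, 0, 0)))) (at p)" for p
    by (rule derivative_eq_intros d refl)+ (simp add: mult_ac)
  hence "((\<lambda>p. 1 :: real) has_derivative (\<lambda>z. 2 * \<alpha> p * t_of (H p z (1, 0, 0)))) (at p)" for p
    unfolding \<alpha>_squared .
  from has_derivative_unique[OF this has_derivative_const]
  have "2 * \<alpha> p * t_of (H p z (1, 0, 0)) = 0" for p z by metis
  moreover have "\<alpha> p \<noteq> 0" for p using \<alpha>_squared[of p] by auto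
  ultimately have "t_of (H p z (1, 0, 0)) = 0" for p z by simp
  hence "(\<alpha> has_derivative (\<lambda>z. 0)) (at p)" for p using d[of p] by simp
  thus ?thesis using has_derivative_zero_constant[OF convex_UNIV, of \<alpha>] by (metis UNIV_I)
qed

definition "\<epsilon> = \<alpha> 0"

lemma \<epsilon>: "\<epsilon> * \<epsilon> = 1" "t_of (L p w) = \<epsilon> * t_of w" "L p (0, 0, 1) = (0, 0, \<epsilon> * exp (2 * f p))"
proof -
  show e: "\<epsilon> * \<epsilon> = 1" using \<alpha>_squared[of 0] by (simp add: \<epsilon>_def power2_eq_square)
  have a: "\<alpha> p = \<epsilon>" unfolding \<epsilon>_def by (rule \<alpha>_constant)
  show "t_of (L p w) = \<epsilon> * t_of w" unfolding L_t a ..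
  have "\<epsilon> * exp (2 * f p) = (\<epsilon> * \<epsilon>) * v_of (L p (0, 0, 1))"
    unfolding \<alpha>_L_v[symmetric] a by simp
  thus "L p (0, 0, 1) = (0, 0, \<epsilon> * exp (2 * f p))" using L_v[of p] e by (simp add: prod_eq_iff)
qed

text \<open>Since d/dv is mapped to \<open>\<epsilon> * exp (2 * f p)\<close> times d/dv, the second
  derivative of \<open>\<phi>\<close> along d/dv is expressed by \<open>df\<close>. The metric
  itself does not change along d/dv, so the differentiated conformal relation becomes an identity
  between \<open>df\<close>, dt and \<open>g\<close>.\<close>

lemma df_zero: "df p u = 0"
proof -
  have H: "H p (0, 0, 1) u = (0, 0, 2 * \<epsilon> * df p u * exp (2 * f p))" for u
  proof -
    have "((\<lambda>q. L q (0, 0, 1)) has_derivative (\<lambda>z. (0, 0, 2 * \<epsilon> * df p z * exp (2 * f p)))) (at p)"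
      unfolding \<epsilon>(3) by (rule derivative_eq_intros f_deriv refl)+ (simp add: mult_ac)
    from fun_cong[OF has_derivative_unique[OF L_deriv this]] show ?thesis
      unfolding H_sym[of p "(0, 0, 1)"] .
  qed
  have "t_of w * df p u + t_of u * df p w = df p (0, 0, 1) * g p u w" for u w
  proof -
    have "exp (2 * f p) * (2 * (\<epsilon> * \<epsilon>) * (t_of w * df p u + t_of u * df p w)) =
        exp (2 * f p) * (2 * (df p (0, 0, 1) * g p u w))"
      using conformal_deriv[of p "(0, 0, 1)" u w] unfolding H \<epsilon>(3) dg_def
      by (simp add: cw_metric_eq[of _ _ "(_, _)"] cw_metric_eq[of _ _ _ "(_, _)"] \<epsilon>(2) algebra_simps)
    thus ?thesis unfolding \<epsilon>(1) by simp
  qed note * = this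
  \<comment> \<open>On a unit spatial vector the left side of \<open>*\<close> vanishes while
    \<open>g\<close> is 1.\<close>
  have "df p (0, 0, 1) = 0"
    using *[of "(0, axis undefined 1, 0)" "(0, axis undefined 1, 0)"] 
    by (simp add: cw_metric_eq inner_axis_axis)
  with * have **: "t_of w * df p u + t_of u * df p w = 0" for u w by simp
  have "df p (1, 0, 0) = 0" using **[of "(1, 0, 0)" "(1, 0, 0)"] by simp
  thus ?thesis using **[of "(1, 0, 0)" u] by simp
qed

end

section \<open>Integration of the affine transformation\<close>

context cw_conformal_nonflat
begin

definition "s = f 0"

lemma f_constant: "f p = s"
proof -
  have "df p = (\<lambda>u. 0)" for p by (rule ext) (rule df_zero)
  hence "(f has_derivative (\<lambda>u. 0)) (at p)" for p using f_deriv[of p] by simp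
  thus ?thesis unfolding s_def
    using has_derivative_zero_constant[OF convex_UNIV, of f] by (metis UNIV_I)
qed

lemma H_eq: "H p u w = L p (\<Gamma> p u w) - \<Gamma> (\<phi> p) (L p u) (L p w)"
proof -
  have "G p = 0" by (rule cw_metric_nondegenerate[of S p]) (simp only: G_grad df_zero)
  hence "C p u w = \<Gamma> p u w" unfolding C_def by (simp add: df_zero)
  thus ?thesis using connection_relation[of p u w] by (simp add: algebra_simps)
qed

lemma L_v_multiple: "L p (0, 0, c) = (0, 0, c * (\<epsilon> * exp (2 * s)))"
proof -
  have "L p (0, 0, c) = L p (c *\<^sub>R (0, 0, 1))" by simp
  also have "\<dots> = c *\<^sub>R L p (0, 0, 1)" by (rule L_lin(3))
  also have "\<dots> = (0, 0, c * (\<epsilon> * exp (2 * s)))" by (simp only: \<epsilon>(3) f_constant scaleR_Pair scaleR_zero_right real_scaleR_def mult_zero_right)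
  finally show ?thesis .
qed

definition "B x = x_of (L 0 (0, x, 0))"

text \<open>Against a spatial vector \<open>\<Gamma>\<close> has only a d/dv component, at
  \<open>p\<close> as well as at \<open>\<phi> p\<close>. Since \<open>L\<close> preserves the d/dv
  line, the spatial part of \<open>H\<close> vanishes, and the spatial block of the differential is
  the same at all points.\<close>

lemma L_x: "x_of (L p (0, x, 0)) = B x"
proof -
  have "x_of (H p z (0, x, 0)) = 0" for p z
    unfolding H_eq by (simp add: cw_\<Gamma>_def \<epsilon>(2) L_v_multiple)
  hence "((\<lambda>q. x_of (L q (0, x, 0))) has_derivative (\<lambda>z. 0)) (at p)" for p
    using L_component_deriv[OF bounded_linear_components(2), of "(0, x, 0)" p] by simp
  from has_derivative_zero_constant[OF convex_UNIV this] show ?thesis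
    unfolding B_def by (metis UNIV_I)
qed

lemma linear_B: "linear B"
  unfolding B_def by (rule linear_spatial_part)

lemmas B_lin = linear_add[OF linear_B] linear_diff[OF linear_B] linear_cmul[OF linear_B]
  linear_neg[OF linear_B] linear_0[OF linear_B]

lemma B_deriv: "(h has_derivative h') F \<Longrightarrow> ((\<lambda>p. B (h p)) has_derivative (\<lambda>u. B (h' u))) F"
  by (rule bounded_linear.has_derivative[OF linear_conv_bounded_linear[THEN iffD1, OF linear_B]])

lemma B_inner: "B x \<bullet> B y = exp (2 * s) * (x \<bullet> y)"
  using conformal[of 0 "(0, x, 0)" "(0, y, 0)"]
  by (simp add: cw_metric_eq \<epsilon>(2) B_def f_constant)

lemma L_x_eq: "x_of (L p u) = B (x_of u) + t_of u *\<^sub>R x_of (L p (1, 0, 0))"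
proof -
  have "u = t_of u *\<^sub>R (1, 0, 0) + (0, x_of u, 0) + (0, 0, v_of u)" by (simp add: prod_eq_iff)
  hence "L p u = t_of u *\<^sub>R L p (1, 0, 0) + L p (0, x_of u, 0) + L p (0, 0, v_of u)"
    by (metis L_lin(1,3))
  thus ?thesis by (simp add: L_x L_v_multiple)
qed

definition "\<beta> t = x_of (\<phi> (t, 0, 0))"
definition "\<beta>' t = x_of (L (t, 0, 0) (1, 0, 0))"

lemma x_of_\<phi>: "x_of (\<phi> p) = B (x_of p) + \<beta> (t_of p)"
proof -
  obtain t y where p: "p = (t, y)" by (cases p)
  have "((\<lambda>y. x_of (\<phi> (t, y)) - B (fst y)) has_derivative (\<lambda>z. 0)) (at y)" for y
  proof -
    have "((\<lambda>y. \<phi> (t, y)) has_derivative (\<lambda>z. L (t, y) (0, z))) (at y)"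
      by (rule has_derivative_compose[OF _ \<phi>_deriv]) (rule derivative_eq_intros refl)+
    hence "((\<lambda>y. x_of (\<phi> (t, y)) - B (fst y)) has_derivative
        (\<lambda>z. x_of (L (t, y) (0, z)) - B (fst z))) (at y)"
      by (intro derivative_intros B_deriv)
    thus ?thesis by (simp add: L_x_eq[of _ "(0, _)"])
  qed
  from has_derivative_zero_constant[OF convex_UNIV this]
  have "x_of (\<phi> (t, y)) - B (fst y) = x_of (\<phi> (t, 0)) - B (fst (0 :: (real^'n) \<times> real))" by (metis UNIV_I)
  thus ?thesis unfolding p \<beta>_def by (simp add: B_lin algebra_simps zero_prod_def)
qed

lemma t_line_deriv: "((\<lambda>r. (r, y)) has_derivative (\<lambda>h. h *\<^sub>R (1, 0))) (at t)"
  by (rule derivative_eq_intros refl)+ simp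

lemma \<phi>_t_line: "((\<lambda>r. x_of (\<phi> (r, y))) has_vector_derivative x_of (L (t, y) (1, 0, 0))) (at t)"
proof -
  have "((\<lambda>r. x_of (\<phi> (r, y))) has_derivative (\<lambda>h. x_of (L (t, y) (h *\<^sub>R (1, 0))))) (at t)"
    by (intro derivative_intros has_derivative_compose[OF t_line_deriv \<phi>_deriv])
  thus ?thesis unfolding has_vector_derivative_def L_lin by (simp add: zero_prod_def)
qed

lemma \<beta>_deriv: "(\<beta> has_vector_derivative \<beta>' t) (at t)"
  using \<phi>_t_line[of "(0, 0)" t] unfolding \<beta>_def \<beta>'_def .

text \<open>In \<open>x_of_\<phi>\<close> the variables separate, so the derivative along d/dt sees
  \<open>\<beta>\<close> alone.\<close>

lemma L_t_\<beta>': "x_of (L p (1, 0, 0)) = \<beta>' (t_of p)"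
proof -
  obtain t y where p: "p = (t, y)" by (cases p)
  have "((\<lambda>r. x_of (\<phi> (r, y))) has_vector_derivative 0 + \<beta>' t) (at t)"
    unfolding x_of_\<phi> fst_conv snd_conv
    by (intro has_vector_derivative_add has_vector_derivative_const \<beta>_deriv)
  with \<phi>_t_line[of y t] show ?thesis unfolding p
    using vector_derivative_unique_at by fastforce
qed

text \<open>The derivative is computed along the d/dt line through an arbitrary \<open>x\<close>,
  although \<open>\<beta>'\<close> does not depend on \<open>x\<close>. The choice
  \<open>x = 0\<close> gives the equation for \<open>\<beta>\<close>, and comparison with the other
  choices shows that \<open>B\<close> commutes with \<open>S\<close>.\<close>

lemma \<beta>'_deriv: "(\<beta>' has_vector_derivative (S *v (B x + \<beta> t) - B (S *v x))) (at t)"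
proof -
  have H: "x_of (H (t, x, 0) (1, 0, 0) (1, 0, 0)) = S *v (B x + \<beta> t) - B (S *v x)"
    unfolding H_eq by (simp add: cw_\<Gamma>_def \<epsilon> L_x x_of_\<phi> B_lin)
  have "((\<lambda>r. x_of (L (r, x, 0) (1, 0, 0))) has_derivative
      (\<lambda>h. x_of (H (t, x, 0) (h *\<^sub>R (1, 0)) (1, 0, 0)))) (at t)"
    by (intro derivative_intros has_derivative_compose[OF t_line_deriv L_deriv])
  hence "((\<lambda>r. x_of (L (r, x, 0) (1, 0, 0))) has_vector_derivative
      x_of (H (t, x, 0) (1, 0, 0) (1, 0, 0))) (at t)"
    unfolding has_vector_derivative_def linear_cmul[OF linear_H(1)] by (simp add: zero_prod_def)
  thus ?thesis unfolding H L_t_\<beta>' by simp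
qed

lemma \<beta>'_deriv_S: "(\<beta>' has_vector_derivative (S *v \<beta> t)) (at t)"
  using \<beta>'_deriv[of 0 t] by (simp add: B_lin)

lemma B_commutes: "S *v B x = B (S *v x)"
  using vector_derivative_unique_at[OF \<beta>'_deriv[of x 0] \<beta>'_deriv_S]
  by (simp add: matrix_vector_right_distrib algebra_simps)

text \<open>The other components of \<open>L\<close> are known, so pairing with the image of d/dt
  determines this one: first for d/dt itself, then for an arbitrary \<open>w\<close>. Because
  \<open>B\<close> commutes with \<open>S\<close> and scales inner products by
  \<open>exp (2 * s)\<close>, the terms quadratic in \<open>x_of p\<close> cancel.\<close>

lemma L_v_eq: "v_of (L p w) = \<epsilon> * (exp (2 * s) * v_of w - \<beta>' (t_of p) \<bullet> B (x_of w)
   - t_of w * (B (x_of p) \<bullet> (S *v \<beta> (t_of p)) + \<beta> (t_of p) \<bullet> (S *v \<beta> (t_of p)) / 2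
       + \<beta>' (t_of p) \<bullet> \<beta>' (t_of p) / 2))"
proof -
  let ?t = "t_of p" and ?x = "x_of p"
  define N where "N = v_of (L p (1, 0, 0))"
  define X where "X = x_of (\<phi> p) \<bullet> (S *v x_of (\<phi> p))"
  have X: "X = exp (2 * s) * (?x \<bullet> (S *v ?x)) + 2 * (B ?x \<bullet> (S *v \<beta> ?t)) + \<beta> ?t \<bullet> (S *v \<beta> ?t)"
    unfolding X_def x_of_\<phi> matrix_vector_right_distrib inner_add_left inner_add_right
      S_swap[of "\<beta> ?t" "B ?x"]
    by (simp add: B_commutes B_inner)
  have 1: "2 * (\<epsilon> * N) + X + \<beta>' ?t \<bullet> \<beta>' ?t = exp (2 * s) * (?x \<bullet> (S *v ?x))"
  proof -
    have "2 * (\<epsilon> * N) + X + \<beta>' ?t \<bullet> \<beta>' ?t = 2 * (\<epsilon> * N) + X * (\<epsilon> * \<epsilon>) + \<beta>' ?t \<bullet> \<beta>' ?t"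
      by (simp only: \<epsilon>(1) mult_1_right)
    also have "\<dots> = g (\<phi> p) (L p (1, 0, 0)) (L p (1, 0, 0))"
      unfolding cw_metric_eq \<epsilon>(2) L_t_\<beta>' X_def N_def by (simp only: fst_conv mult_1_right mult.commute mult_2)
    also have "\<dots> = exp (2 * s) * g p (1, 0, 0) (1, 0, 0)"
      by (simp only: conformal f_constant)
    also have "g p (1, 0, 0) (1, 0, 0) = ?x \<bullet> (S *v ?x)" by (simp add: cw_metric_eq)
    finally show ?thesis .
  qed
  have 2: "\<epsilon> * (t_of w * N) + \<epsilon> * v_of (L p w) + X * t_of w + \<beta>' ?t \<bullet> B (x_of w)
      + t_of w * (\<beta>' ?t \<bullet> \<beta>' ?t) = exp (2 * s) * (v_of w + (?x \<bullet> (S *v ?x)) * t_of w)"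
  proof -
    have e: "\<epsilon> * (\<epsilon> * y) = y" for y using \<epsilon>(1) by (metis mult.assoc mult_1)
    have "\<epsilon> * (t_of w * N) + \<epsilon> * v_of (L p w) + X * t_of w + \<beta>' ?t \<bullet> B (x_of w)
      + t_of w * (\<beta>' ?t \<bullet> \<beta>' ?t) = g (\<phi> p) (L p (1, 0, 0)) (L p w)"
      unfolding cw_metric_eq \<epsilon>(2) L_x_eq[of p w] L_t_\<beta>' X_def N_def
      by (simp add: inner_add_right e mult_ac)
    also have "\<dots> = exp (2 * s) * g p (1, 0, 0) w"
      by (simp only: conformal f_constant)
    also have "g p (1, 0, 0) w = v_of w + (?x \<bullet> (S *v ?x)) * t_of w" by (simp add: cw_metric_eq)
    finally show ?thesis .
  qed
  \<comment> \<open>Scaled by \<open>t_of w\<close>, the first relation can be subtracted linearly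
    from the second to eliminate \<open>N\<close>.\<close>
  have w1: "t_of w * (2 * (\<epsilon> * N) + X + \<beta>' ?t \<bullet> \<beta>' ?t) = t_of w * (exp (2 * s) * (?x \<bullet> (S *v ?x)))"
    by (simp only: 1)
  have "\<epsilon> * v_of (L p w) = exp (2 * s) * v_of w - \<beta>' ?t \<bullet> B (x_of w)
   - t_of w * (B ?x \<bullet> (S *v \<beta> ?t) + \<beta> ?t \<bullet> (S *v \<beta> ?t) / 2 + \<beta>' ?t \<bullet> \<beta>' ?t / 2)"
    using w1 2 unfolding X by (simp add: algebra_simps)
  moreover have "v_of (L p w) = \<epsilon> * (\<epsilon> * v_of (L p w))" using \<epsilon>(1) by (metis mult.assoc mult_1)
  ultimately show ?thesis by simp
qed

lemma t_of_\<phi>: "t_of (\<phi> p) = \<epsilon> * t_of p + t_of (\<phi> 0)"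
proof -
  have "((\<lambda>q. t_of (\<phi> q) - \<epsilon> * t_of q) has_derivative (\<lambda>u. t_of (L p u) - \<epsilon> * t_of u)) (at p)" for p
    by (intro derivative_intros \<phi>_deriv)
  hence "((\<lambda>q. t_of (\<phi> q) - \<epsilon> * t_of q) has_derivative (\<lambda>u. 0)) (at p)" for p
    by (simp add: \<epsilon>(2))
  from has_derivative_zero_constant[OF convex_UNIV this]
  have "t_of (\<phi> p) - \<epsilon> * t_of p = t_of (\<phi> 0) - \<epsilon> * t_of (0 :: real \<times> (real^'n) \<times> real)" by (metis UNIV_I)
  thus ?thesis by simp
qed

text \<open>The last component of the normal form without \<open>b\<close>. The equation for
  \<open>\<beta>\<close> makes its derivative agree with \<open>L_v_eq\<close>, which leaves a
  constant of integration.\<close>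

definition "W p = \<epsilon> * (exp (2 * s) * v_of p - \<beta>' (t_of p) \<bullet> (B (x_of p) + (1 / 2) *\<^sub>R \<beta> (t_of p)))"

lemma v_of_\<phi>: "v_of (\<phi> p) = W p + v_of (\<phi> 0) - W 0"
proof -
  have "((\<lambda>q. v_of (\<phi> q) - W q) has_derivative (\<lambda>u. 0)) (at p)" for p
  proof -
    note \<beta>t = has_derivative_compose[OF has_derivative_fst[OF has_derivative_ident]
        \<beta>_deriv[unfolded has_vector_derivative_def]]
    note \<beta>'t = has_derivative_compose[OF has_derivative_fst[OF has_derivative_ident]
        \<beta>'_deriv_S[unfolded has_vector_derivative_def]]
    have "(W has_derivative (\<lambda>w. \<epsilon> * (exp (2 * s) * v_of w
        - (\<beta>' (t_of p) \<bullet> (B (x_of w) + (1 / 2) *\<^sub>R (t_of w *\<^sub>R \<beta>' (t_of p)))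
           + (t_of w *\<^sub>R (S *v \<beta> (t_of p))) \<bullet> (B (x_of p) + (1 / 2) *\<^sub>R \<beta> (t_of p)))))) (at p)"
      unfolding W_def by (rule derivative_eq_intros B_deriv \<beta>t \<beta>'t refl)+ simp
    also have "(\<lambda>w. \<epsilon> * (exp (2 * s) * v_of w
        - (\<beta>' (t_of p) \<bullet> (B (x_of w) + (1 / 2) *\<^sub>R (t_of w *\<^sub>R \<beta>' (t_of p)))
           + (t_of w *\<^sub>R (S *v \<beta> (t_of p))) \<bullet> (B (x_of p) + (1 / 2) *\<^sub>R \<beta> (t_of p)))))
      = (\<lambda>w. v_of (L p w))"
      unfolding L_v_eq inner_commute[of _ "S *v \<beta> (t_of p)"]
      by (intro ext) (simp add: inner_add_right algebra_simps)
    finally have "(W has_derivative (\<lambda>w. v_of (L p w))) (at p)" .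
    moreover have "((\<lambda>q. v_of (\<phi> q)) has_derivative (\<lambda>w. v_of (L p w))) (at p)"
      by (intro derivative_intros \<phi>_deriv)
    ultimately show ?thesis using has_derivative_diff by fastforce
  qed
  from has_derivative_zero_constant[OF convex_UNIV this]
  have "v_of (\<phi> p) - W p = v_of (\<phi> 0) - W 0" by (metis UNIV_I)
  thus ?thesis by simp
qed

lemma cw_map_form:
  "\<exists>c \<epsilon> b \<beta> A s. cw_admissible S \<epsilon> \<beta> A \<and> \<phi> = cw_map c \<epsilon> b \<beta> A s"
proof -
  \<comment> \<open>\<open>B\<close> scales lengths by \<open>exp s\<close>; dividing by this factor
    leaves an orthogonal map.\<close>
  define A where "A = matrix (\<lambda>x. exp (- s) *\<^sub>R B x)"
  have lin: "linear (\<lambda>x. exp (- s) *\<^sub>R B x)" by (intro linear_compose_scale_right linear_B)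
  have A: "A *v x = exp (- s) *\<^sub>R B x" for x unfolding A_def using matrix_vector_mul(2)[OF lin] by metis
  have B: "exp s *\<^sub>R (A *v x) = B x" for x unfolding A by (simp flip: exp_add)
  have "orthogonal_transformation (\<lambda>x. exp (- s) *\<^sub>R B x)"
    unfolding orthogonal_transformation_def using lin
    by (simp add: B_inner flip: exp_add mult.assoc)
  hence "orthogonal_matrix A" unfolding A_def orthogonal_transformation_matrix by blast
  moreover have "A ** S = S ** A"
    unfolding matrix_eq by (simp add: A matrix_vector_mul_assoc[symmetric] matrix_vector_mult_scaleR B_commutes)
  moreover have "cw_solution S \<beta>" unfolding cw_solution_def using \<beta>_deriv \<beta>'_deriv_S by blast
  moreover have "\<epsilon> \<in> {1, -1}" using \<epsilon>(1) by (simp add: square_eq_1_iff)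
  ultimately have adm: "cw_admissible S \<epsilon> \<beta> A" unfolding cw_admissible_def by blast
  have vd: "vector_derivative \<beta> (at t) = \<beta>' t" for t
    by (rule vector_derivative_at[OF \<beta>_deriv])
  \<comment> \<open>\<open>cw_map\<close> multiplies its parameter \<open>b\<close> by
    \<open>\<epsilon>\<close>. As \<open>\<epsilon>\<close> is its own inverse, the constant of
    integration is passed on with one factor \<open>\<epsilon>\<close>.\<close>
  have "\<phi> p = cw_map (t_of (\<phi> 0)) \<epsilon> (\<epsilon> * (v_of (\<phi> 0) - W 0)) \<beta> A s p" for p
  proof -
    have e: "\<epsilon> * (\<epsilon> * y) = y" for y using \<epsilon>(1) by (metis mult.assoc mult_1)
    have "v_of (\<phi> p) = \<epsilon> * (exp (2 * s) * v_of p + \<epsilon> * (v_of (\<phi> 0) - W 0)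
        - \<beta>' (t_of p) \<bullet> (B (x_of p) + (1 / 2) *\<^sub>R \<beta> (t_of p)))"
      unfolding v_of_\<phi>[of p] W_def[of p] by (simp add: distrib_left right_diff_distrib e)
    thus ?thesis unfolding cw_map_def B vd
      using t_of_\<phi>[of p] x_of_\<phi>[of p] by (simp add: prod_eq_iff split: prod.splits)
  qed
  thus ?thesis using adm by blast
qed

end

section \<open>Homotheties and their fixed points\<close>

lemma diffeo_deriv:
  assumes "diffeo UNIV UNIV \<phi>"
  shows "(\<phi> has_derivative frechet_derivative \<phi> (at p)) (at p)"
proof -
  have "smooth_on UNIV \<phi>" using assms unfolding diffeo_def by blast
  thus ?thesis by (rule smooth_onD2(1))
qed

lemma homothety_imp_conformal_transformation:
  assumes "diffeo UNIV UNIV \<phi>" "\<And>p. pullback \<phi> g p = conformal_change (\<lambda>_. s) g p"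
  shows "conformal_transformation UNIV g \<phi>"
proof -
  have "smooth_on UNIV (\<lambda>_. s)" unfolding smooth_on_def using Ck_on_const[OF open_UNIV] by blast
  thus ?thesis using assms unfolding conformal_transformation_def conformal_diffeo_def by blast
qed

lemma conformal_change_zero: "conformal_change (\<lambda>_. 0) g = g"
  by (intro ext) (simp add: conformal_change_def)

lemma essential_imp_not_isometry:
  assumes "essential UNIV g \<phi>"
  shows "\<not> isometry UNIV g \<phi>"
proof
  assume iso: "isometry UNIV g \<phi>"
  have "smooth_on UNIV (\<lambda>_. 0 :: real)" unfolding smooth_on_def using Ck_on_const[OF open_UNIV] by blast
  moreover have "isometry UNIV (conformal_change (\<lambda>_. 0) g) \<phi>" unfolding conformal_change_zero by (rule iso)
  ultimately show False using assms unfolding essential_def by blast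
qed

lemma fixed_point_imp_essential:
  assumes \<phi>: "diffeo UNIV UNIV \<phi>" "\<And>p. pullback \<phi> g p = conformal_change (\<lambda>_. s) g p"
    and s: "s \<noteq> 0" and fp: "\<phi> p = p" and nz: "g p u w \<noteq> 0"
  shows "essential UNIV g \<phi>"
  unfolding essential_def
proof (intro conjI notI homothety_imp_conformal_transformation[OF \<phi>])
  assume "\<exists>h. smooth_on UNIV h \<and> isometry UNIV (conformal_change h g) \<phi>"
  then obtain h where "isometry UNIV (conformal_change h g) \<phi>" by blast
  hence "pullback \<phi> (conformal_change h g) p u w = conformal_change h g p u w"
    unfolding isometry_def by simp
  hence "exp (2 * h p) * pullback \<phi> g p u w = exp (2 * h p) * g p u w"
    unfolding pullback_def conformal_change_def fp .
  hence "exp (2 * s) * g p u w = g p u w" unfolding \<phi>(2) conformal_change_def by simp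
  thus False using s nz by simp
qed

text \<open>If \<open>h\<close> decreases by \<open>s\<close> along \<open>\<phi>\<close>, then \<open>exp (2 h) g\<close> absorbs the homothety factor.\<close>

lemma not_essential_if_potential:
  assumes \<phi>: "diffeo UNIV UNIV \<phi>" "\<And>p. pullback \<phi> g p = conformal_change (\<lambda>_. s) g p"
    and h: "smooth_on UNIV h" "\<And>p. h (\<phi> p) = h p - s"
  shows "\<not> essential UNIV g \<phi>"
proof -
  have "pullback \<phi> (conformal_change h g) p = conformal_change h g p" for p
  proof (intro ext)
    fix u w
    have "pullback \<phi> (conformal_change h g) p u w = exp (2 * h (\<phi> p)) * pullback \<phi> g p u w"
      unfolding pullback_def conformal_change_def ..
    also have "\<dots> = (exp (2 * (h p - s)) * exp (2 * s)) * g p u w"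
      unfolding \<phi>(2) conformal_change_def h(2) by simp
    also have "exp (2 * (h p - s)) * exp (2 * s) = exp (2 * h p)"
      by (simp flip: exp_add)
    finally show "pullback \<phi> (conformal_change h g) p u w = conformal_change h g p u w"
      unfolding conformal_change_def .
  qed
  thus ?thesis using \<phi>(1) h(1) unfolding essential_def isometry_def by blast
qed

section \<open>Scale and fixed points of the normal form\<close>

lemma cw_map_components:
  "t_of (cw_map c \<epsilon> b \<beta> A s p) = \<epsilon> * t_of p + c"
  "x_of (cw_map c \<epsilon> b \<beta> A s p) = exp s *\<^sub>R (A *v x_of p) + \<beta> (t_of p)"
  "v_of (cw_map c \<epsilon> b \<beta> A s p) = \<epsilon> * (exp (2 * s) * v_of p + b
     - vector_derivative \<beta> (at (t_of p)) \<bullet> (exp s *\<^sub>R (A *v x_of p) + (1/2) *\<^sub>R \<beta> (t_of p)))"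
  by (simp_all add: cw_map_def split: prod.splits)

lemma orthogonal_matrix_inner:
  fixes A :: "real^'n^'n"
  assumes "orthogonal_matrix A"
  shows "(A *v x) \<bullet> (A *v y) = x \<bullet> y"
proof -
  have "orthogonal_transformation ((*v) A)"
    using assms unfolding orthogonal_transformation_matrix by simp
  thus ?thesis unfolding orthogonal_transformation_def by blast
qed

text \<open>One unit spatial vector at the origin decides the factor. Along the corresponding line
  \<open>t\<close> stays 0, so \<open>\<beta>\<close> is constant there; the t-component of the
  derivative vanishes, and with it the contribution of the last coordinate to the metric.\<close>

lemma cw_map_scale:
  fixes S :: "real^'n^'n"
  assumes adm: "cw_admissible S \<epsilon> \<beta> A" and \<phi>: "\<phi> = cw_map c \<epsilon> b \<beta> A s"
    and d: "diffeo UNIV UNIV \<phi>"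
    and pb: "\<And>p. pullback \<phi> (cw_metric S) p = conformal_change (\<lambda>_. s') (cw_metric S) p"
  shows "s' = s"
proof -
  define x :: "real^'n" where "x = axis undefined 1"
  have x: "x \<bullet> x = 1" by (simp add: x_def inner_axis_axis)
  define D where "D = frechet_derivative \<phi> (at 0) (0, x, 0)"
  have line: "((\<lambda>r. r *\<^sub>R (0, x, 0)) has_derivative (\<lambda>h. h *\<^sub>R (0, x, 0))) (at (0::real))"
    by (rule derivative_eq_intros refl)+
  have lin: "linear (frechet_derivative \<phi> (at 0))"
    using diffeo_deriv[OF d] has_derivative_linear by blast
  have "((\<lambda>r. \<phi> (r *\<^sub>R (0, x, 0))) has_derivative
      (\<lambda>h. frechet_derivative \<phi> (at 0) (h *\<^sub>R (0, x, 0)))) (at (0::real))"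
    by (rule has_derivative_compose[OF line]) (use diffeo_deriv[OF d, of 0] in \<open>simp add: zero_prod_def\<close>)
  hence \<phi>d: "((\<lambda>r. \<phi> (r *\<^sub>R (0, x, 0))) has_derivative (\<lambda>h. h *\<^sub>R D)) (at (0::real))"
    unfolding linear_cmul[OF lin] D_def .
  have "((\<lambda>r. t_of (\<phi> (r *\<^sub>R (0, x, 0)))) has_derivative (\<lambda>h. t_of (h *\<^sub>R D))) (at (0::real))"
    by (intro derivative_intros \<phi>d)
  moreover have "((\<lambda>r. t_of (\<phi> (r *\<^sub>R (0, x, 0)))) has_derivative (\<lambda>h. 0)) (at (0::real))"
    unfolding \<phi> cw_map_components by simp
  ultimately have "(\<lambda>h. t_of (h *\<^sub>R D)) = (\<lambda>h. 0)" by (rule has_derivative_unique)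
  from fun_cong[OF this, of 1] have tD: "t_of D = 0" by simp
  have "((\<lambda>r. x_of (\<phi> (r *\<^sub>R (0, x, 0)))) has_derivative (\<lambda>h. x_of (h *\<^sub>R D))) (at (0::real))"
    by (intro derivative_intros \<phi>d)
  moreover have "((\<lambda>r. x_of (\<phi> (r *\<^sub>R (0, x, 0)))) has_derivative (\<lambda>h. h *\<^sub>R (exp s *\<^sub>R (A *v x)))) (at (0::real))"
    unfolding \<phi> cw_map_components
    by (simp add: matrix_vector_mult_scaleR)
       (rule derivative_eq_intros refl | simp add: mult.commute)+
  ultimately have "(\<lambda>h. x_of (h *\<^sub>R D)) = (\<lambda>h. h *\<^sub>R (exp s *\<^sub>R (A *v x)))" by (rule has_derivative_unique)
  from fun_cong[OF this, of 1] have xD: "x_of D = exp s *\<^sub>R (A *v x)" by simp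
  have "pullback \<phi> (cw_metric S) 0 (0, x, 0) (0, x, 0) = exp (2 * s') * cw_metric S 0 (0, x, 0) (0, x, 0)"
    unfolding pb conformal_change_def ..
  hence "x_of D \<bullet> x_of D = exp (2 * s')"
    unfolding pullback_def D_def[symmetric] by (simp add: cw_metric_eq tD x)
  moreover have "x_of D \<bullet> x_of D = exp (2 * s)"
    using adm unfolding xD cw_admissible_def
    by (simp add: orthogonal_matrix_inner x flip: exp_add)
  ultimately show ?thesis by simp
qed

text \<open>The fixed point equations are triangular: \<open>t\<close> alone, then \<open>x\<close>
  for that \<open>t\<close>, then \<open>v\<close>. The last two are always solvable because
  \<open>s\<close> is nonzero, so the condition comes from the equation for
  \<open>t\<close>.\<close>

lemma cw_map_fixed_point:
  fixes A :: "real^'n^'n"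
  assumes A: "orthogonal_matrix A" and \<epsilon>: "\<epsilon> \<in> {1, -1}" and s: "s \<noteq> 0"
  shows "(\<exists>p. cw_map c \<epsilon> b \<beta> A s p = p) \<longleftrightarrow> \<epsilon> = -1 \<or> c = 0"
proof
  assume "\<exists>p. cw_map c \<epsilon> b \<beta> A s p = p"
  then obtain p where "cw_map c \<epsilon> b \<beta> A s p = p" ..
  hence "\<epsilon> * t_of p + c = t_of p" using cw_map_components(1) by metis
  thus "\<epsilon> = -1 \<or> c = 0" using \<epsilon> by auto
next
  assume "\<epsilon> = -1 \<or> c = 0"
  hence "\<exists>t. \<epsilon> * t + c = t"
  proof
    assume "\<epsilon> = -1"
    hence "\<epsilon> * (c / 2) + c = c / 2" by simp
    thus ?thesis ..
  qed (use \<epsilon> in \<open>auto intro: exI[of _ 0]\<close>)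
  then obtain t where t: "\<epsilon> * t + c = t" ..
  have lin: "linear (\<lambda>x. x - exp s *\<^sub>R (A *v x))"
    by (intro linear_compose_sub linear_id[unfolded id_def] linear_compose_scale_right matrix_vector_mul_linear)
  \<comment> \<open>A vector fixed by \<open>exp s\<close> times an orthogonal map has its squared
    length multiplied by \<open>exp (2 * s)\<close>, which differs from 1.\<close>
  have "surj (\<lambda>x. x - exp s *\<^sub>R (A *v x))"
  proof (rule linear_inj_imp_surj[OF lin], subst linear_injective_0[OF lin], safe)
    fix x assume "x - exp s *\<^sub>R (A *v x) = 0"
    hence "x = exp s *\<^sub>R (A *v x)" by simp
    hence "x \<bullet> x = (exp s *\<^sub>R (A *v x)) \<bullet> (exp s *\<^sub>R (A *v x))" by simp
    also have "\<dots> = exp (2 * s) * (x \<bullet> x)"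
      by (simp add: orthogonal_matrix_inner[OF A] flip: exp_add)
    finally show "x = 0" using s by simp
  qed
  from surjD[OF this, of "\<beta> t"] obtain x where x: "\<beta> t = x - exp s *\<^sub>R (A *v x)" ..
  define k where "k = b - vector_derivative \<beta> (at t) \<bullet> (exp s *\<^sub>R (A *v x) + (1/2) *\<^sub>R \<beta> t)"
  \<comment> \<open>The solution of v = \<epsilon> (exp(2s) v + k). The denominator is nonzero:
    exp(2s) is positive, and it differs from 1 because \<open>s\<close> is nonzero.\<close>
  define v where "v = \<epsilon> * k / (1 - \<epsilon> * exp (2 * s))"
  have "exp (2 * s) \<noteq> - 1" using exp_gt_zero[of "2 * s"] by linarith
  hence "1 - \<epsilon> * exp (2 * s) \<noteq> 0"
    using \<epsilon> s by (auto simp: add_eq_0_iff)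
  hence v: "\<epsilon> * (exp (2 * s) * v + k) = v" unfolding v_def by (simp add: field_simps)
  have x_fixed: "exp s *\<^sub>R (A *v x) + \<beta> t = x" by (simp add: x)
  have "cw_map c \<epsilon> b \<beta> A s (t, x, v) = (t, x, v)"
    using t v x_fixed unfolding k_def prod_eq_iff cw_map_components fst_conv snd_conv add_diff_eq
    by (intro conjI)
  thus "\<exists>p. cw_map c \<epsilon> b \<beta> A s p = p" ..
qed

lemma cw_homothety_essential:
  fixes S :: "real^'n^'n"
  assumes adm: "cw_admissible S \<epsilon> \<beta> A"
    and hom: "homothety UNIV (cw_metric S) (cw_map c \<epsilon> b \<beta> A s)"
    and not_iso: "\<not> isometry UNIV (cw_metric S) (cw_map c \<epsilon> b \<beta> A s)"
  shows "essential UNIV (cw_metric S) (cw_map c \<epsilon> b \<beta> A s) \<longleftrightarrow> (\<exists>p. cw_map c \<epsilon> b \<beta> A s p = p)"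
    and "(\<exists>p. cw_map c \<epsilon> b \<beta> A s p = p) \<longleftrightarrow> \<epsilon> = -1 \<or> c = 0"
proof -
  define \<phi> where "\<phi> = cw_map c \<epsilon> b \<beta> A s"
  obtain s' where d: "diffeo UNIV UNIV \<phi>"
    and pb': "\<And>p. pullback \<phi> (cw_metric S) p = conformal_change (\<lambda>_. s') (cw_metric S) p"
    using hom unfolding homothety_def \<phi>_def by blast
  \<comment> \<open>From here on the homothety factor is the parameter of the normal form, so not
    being an isometry means \<open>s \<noteq> 0\<close>.\<close>
  have "s' = s" by (rule cw_map_scale[OF adm \<phi>_def d pb'])
  note pb = pb'[unfolded this]
  have s: "s \<noteq> 0"
  proof
    assume "s = 0"
    hence "isometry UNIV (cw_metric S) \<phi>"
      using d pb unfolding isometry_def by (simp add: conformal_change_zero)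
    thus False using not_iso unfolding \<phi>_def by contradiction
  qed
  have \<epsilon>: "\<epsilon> \<in> {1, -1}" and A: "orthogonal_matrix A" using adm unfolding cw_admissible_def by auto
  show fixed: "(\<exists>p. cw_map c \<epsilon> b \<beta> A s p = p) \<longleftrightarrow> \<epsilon> = -1 \<or> c = 0"
    by (rule cw_map_fixed_point[OF A \<epsilon> s])
  show "essential UNIV (cw_metric S) (cw_map c \<epsilon> b \<beta> A s) \<longleftrightarrow> (\<exists>p. cw_map c \<epsilon> b \<beta> A s p = p)"
  proof
    assume "\<exists>p. cw_map c \<epsilon> b \<beta> A s p = p"
    then obtain p where p: "\<phi> p = p" unfolding \<phi>_def ..
    have "cw_metric S p (1, 0, 0) (0, 0, 1) \<noteq> 0" by (simp add: cw_metric_eq)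
    from fixed_point_imp_essential[OF d pb s p this]
    show "essential UNIV (cw_metric S) (cw_map c \<epsilon> b \<beta> A s)" unfolding \<phi>_def .
  next
    assume ess: "essential UNIV (cw_metric S) (cw_map c \<epsilon> b \<beta> A s)"
    show "\<exists>p. cw_map c \<epsilon> b \<beta> A s p = p"
    proof (rule ccontr)
      assume "\<not> (\<exists>p. cw_map c \<epsilon> b \<beta> A s p = p)"
      hence c: "\<epsilon> = 1" "c \<noteq> 0" using fixed \<epsilon> by auto
      have "bounded_linear (\<lambda>p :: real \<times> (real^'n) \<times> real. - (s / c) * t_of p)"
        by (intro bounded_linear_const_mult bounded_linear_fst)
      hence "smooth_on UNIV (\<lambda>p :: real \<times> (real^'n) \<times> real. - (s / c) * t_of p)"
        unfolding smooth_on_def using Ck_on_bounded_linear[OF open_UNIV] by blast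
      moreover have "- (s / c) * t_of (\<phi> p) = - (s / c) * t_of p - s" for p
        unfolding \<phi>_def cw_map_components using c by (simp add: field_simps)
      ultimately have "\<not> essential UNIV (cw_metric S) \<phi>"
        by (rule not_essential_if_potential[OF d pb])
      thus False using ess unfolding \<phi>_def by contradiction
    qed
  qed
qed

section \<open>Conformal transformations of spaces that are not conformally flat\<close>

lemma cw_conformal_transformation_form:
  fixes S :: "real^'n^'n"
  assumes S: "transpose S = S" and not_flat: "\<not> conformally_flat UNIV (cw_metric S)"
    and conf: "conformal_transformation UNIV (cw_metric S) \<phi>"
  shows "homothety UNIV (cw_metric S) \<phi>"
    and "\<exists>c \<epsilon> b \<beta> A s. cw_admissible S \<epsilon> \<beta> A \<and> \<phi> = cw_map c \<epsilon> b \<beta> A s"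
proof -
  obtain f where d: "diffeo UNIV UNIV \<phi>" and f: "smooth_on UNIV f"
    and pb: "\<And>p. pullback \<phi> (cw_metric S) p = conformal_change f (cw_metric S) p"
    using conf unfolding conformal_transformation_def conformal_diffeo_def by blast
  interpret cw_conformal_nonflat S \<phi> f
  proof
    show "x \<bullet> (S *v y) = (S *v x) \<bullet> y" for x y by (rule symmetric_matrix_inner[OF S])
    show "smooth_on UNIV \<phi>" using d unfolding diffeo_def by blast
    show "\<not> (\<exists>\<mu>. \<forall>x. x \<bullet> (S *v x) = \<mu> * (x \<bullet> x))"
      using cw_conformally_flat not_flat by metis
  qed (rule f pb)+
  have "conformal_change f (cw_metric S) p = conformal_change (\<lambda>_. s) (cw_metric S) p" for p
    by (intro ext) (simp only: conformal_change_def f_constant)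
  thus "homothety UNIV (cw_metric S) \<phi>" unfolding homothety_def using d pb by metis
  show "\<exists>c \<epsilon> b \<beta> A s. cw_admissible S \<epsilon> \<beta> A \<and> \<phi> = cw_map c \<epsilon> b \<beta> A s" by (rule cw_map_form)
qed

theorem theorem1p2:
  fixes S :: "real^'n^'n"
  assumes "transpose S = S" and "det S \<noteq> 0"
  shows
    "(\<forall>c \<epsilon> b \<beta> A s.
        cw_admissible S \<epsilon> \<beta> A \<and>
        homothety UNIV (cw_metric S) (cw_map c \<epsilon> b \<beta> A s) \<and>
        \<not> isometry UNIV (cw_metric S) (cw_map c \<epsilon> b \<beta> A s) \<longrightarrow>
        (essential UNIV (cw_metric S) (cw_map c \<epsilon> b \<beta> A s) \<longleftrightarrow>
           (\<exists>p. cw_map c \<epsilon> b \<beta> A s p = p)) \<and>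
        ((\<exists>p. cw_map c \<epsilon> b \<beta> A s p = p) \<longleftrightarrow> \<epsilon> = -1 \<or> c = 0)) \<and>
     (\<not> conformally_flat UNIV (cw_metric S) \<longrightarrow>
        (\<forall>\<phi>. essential UNIV (cw_metric S) \<phi> \<longrightarrow>
           homothety UNIV (cw_metric S) \<phi> \<and>
           \<not> isometry UNIV (cw_metric S) \<phi> \<and>
           (\<exists>p. \<phi> p = p) \<and>
           (\<exists>c \<epsilon> b \<beta> A s. cw_admissible S \<epsilon> \<beta> A \<and> \<phi> = cw_map c \<epsilon> b \<beta> A s \<and>
              (\<epsilon> = -1 \<or> c = 0))))"
proof (rule conjI)
  show "\<forall>c \<epsilon> b \<beta> A s.
        cw_admissible S \<epsilon> \<beta> A \<and>
        homothety UNIV (cw_metric S) (cw_map c \<epsilon> b \<beta> A s) \<and>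
        \<not> isometry UNIV (cw_metric S) (cw_map c \<epsilon> b \<beta> A s) \<longrightarrow>
        (essential UNIV (cw_metric S) (cw_map c \<epsilon> b \<beta> A s) \<longleftrightarrow>
           (\<exists>p. cw_map c \<epsilon> b \<beta> A s p = p)) \<and>
        ((\<exists>p. cw_map c \<epsilon> b \<beta> A s p = p) \<longleftrightarrow> \<epsilon> = -1 \<or> c = 0)"
    by (intro allI impI conjI; elim conjE) (rule cw_homothety_essential; assumption)+
  show "\<not> conformally_flat UNIV (cw_metric S) \<longrightarrow>
        (\<forall>\<phi>. essential UNIV (cw_metric S) \<phi> \<longrightarrow>
           homothety UNIV (cw_metric S) \<phi> \<and>
           \<not> isometry UNIV (cw_metric S) \<phi> \<and>
           (\<exists>p. \<phi> p = p) \<and>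
           (\<exists>c \<epsilon> b \<beta> A s. cw_admissible S \<epsilon> \<beta> A \<and> \<phi> = cw_map c \<epsilon> b \<beta> A s \<and>
              (\<epsilon> = -1 \<or> c = 0)))"
  proof (rule impI, rule allI, rule impI)
    fix \<phi>
    assume not_flat: "\<not> conformally_flat UNIV (cw_metric S)" and ess: "essential UNIV (cw_metric S) \<phi>"
    have conf: "conformal_transformation UNIV (cw_metric S) \<phi>" using ess unfolding essential_def by (rule conjunct1)
    note form = cw_conformal_transformation_form[OF assms(1) not_flat conf]
    have niso: "\<not> isometry UNIV (cw_metric S) \<phi>" by (rule essential_imp_not_isometry[OF ess])
    obtain c \<epsilon> b \<beta> A s where adm: "cw_admissible S \<epsilon> \<beta> A" and \<phi>: "\<phi> = cw_map c \<epsilon> b \<beta> A s"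
      using form(2) by (elim exE conjE)
    \<comment> \<open>The essential transformation is now a homothety in normal form and not an
      isometry, so the equivalence of the first half applies to it.\<close>
    note equiv = cw_homothety_essential[OF adm form(1)[unfolded \<phi>] niso[unfolded \<phi>]]
    have fixed: "\<exists>p. \<phi> p = p" using equiv(1) ess unfolding \<phi> by (rule iffD1)
    hence "\<epsilon> = -1 \<or> c = 0" using equiv(2) unfolding \<phi> by simp
    thus "homothety UNIV (cw_metric S) \<phi> \<and> \<not> isometry UNIV (cw_metric S) \<phi> \<and> (\<exists>p. \<phi> p = p) \<and>
       (\<exists>c \<epsilon> b \<beta> A s. cw_admissible S \<epsilon> \<beta> A \<and> \<phi> = cw_map c \<epsilon> b \<beta> A s \<and> (\<epsilon> = -1 \<or> c = 0))"
      using adm \<phi> by (intro conjI form(1) niso fixed) (intro exI conjI)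
  qed
qed

end
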